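(* Let $\psi$ be admissible. The operator $a\mapsto\sum_{Q\in\mathcal Q}a_Q\psi_Q$, defined for sequences $a=\{a_Q\}_{Q\in\mathcal Q}$ of finite support, has an extension to a linear map $$T_\psi\colon\ \bigcap_{\phi\in\mathcal Z}L_1(\mathcal Q,\langle\psi_Q,\phi\rangle\,d\tau_{1+n})\to\mathcal Z'(\mathbb{R}^n),$$ which on each sequence $a=\{a_Q\}$ in the intersection is given as an element of $\mathcal Z'(\mathbb{R}^n)$ by $$\langle T_\psi a,\phi\rangle=\int_{\mathcal Q}a_Q\langle\psi_Q,\phi\rangle\,d\tau_{1+n}\qquad\text{for }\phi\in\mathcal Z(\mathbb{R}^n).$$ Moreover, for every $a$ in the intersection, $T_\psi a$ equals the w$^*$-limit in $\mathcal Z'(\mathbb{R}^n)$ of $T_\psi a^{(m)}$, $m\to\infty$, for arbitrary approximation of $a$ by truncations $a^{(m)}=\mathbf 1_{\mathcal Q_m}a$ having finite, increasing supports that exhaust $\operatorname{supp}a$ (where $\mathcal Q_1\subset\mathcal Q_2\subset\dots$ are finite subsets of $\mathcal Q$ whose union contains $\operatorname{supp}a$). This property determines the extension $T_\psi$ uniquely.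
   Context: Fourier transform: $\hat f(\xi)=\int e^{-i x\cdot\xi}f(x)\,dx$ on $\mathbb{R}^n$. Pairings are anti-linear in the second slot: $\langle f,\phi\rangle=\int f\overline{\phi}\,dx$ for functions. $\mathcal S$, $\mathcal S'$ are the Schwartz functions and tempered distributions on $\mathbb{R}^n$. Admissibility: fix constants $0<K_0<K_1<1<K^1<K^0$ with $2K_1<K^1$ and $K^0<\pi$. A function $\psi\in\mathcal S$ is admissible if $\operatorname{supp}\hat\psi\subset\{\xi: K_0\le|\xi|\le K^0\}$ and, for some $c>0$, $|\hat\psi(\xi)|\ge c$ for $K_1\le|\xi|\le K^1$. Dyadic cubes: for $\nu\in\mathbb{Z}$, $k\in\mathbb{Z}^n$, $Q_{\nu k}=\{x\in\mathbb{R}^n: k_i\le 2^\nu x_i<k_i+1,\ i=1,\dots,n\}$; $\mathcal Q\simeq\mathbb{Z}\times\mathbb{Z}^n$ is the set of all of these, and $\tau_{1+n}$ is the counting measure on $\mathcal Q$. For $Q=Q_{\nu k}$ set $\psi_Q(x)=2^{n\nu/2}\psi(2^\nu x-k)$. $\mathcal P$ is the space of polynomials; $\mathcal Z=\{\phi\in\mathcal S:\int x^\alpha\phi(x)\,dx=0\ \text{for all multiindices }\alpha\}$ with topology from $\mathcal S$ (a Fréchet space); $\mathcal Z'=\mathcal S'/\mathcal P$ is its dual with the w$^*$-topology. Each $\psi_Q$ is identified with its class in $\mathcal Z'$. A "sequence" is a family $a=\{a_Q\}_{Q\in\mathcal Q}$ of complex numbers; its support is $\{Q: a_Q\ne0\}$.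 $L_1(\mathcal Q,\langle\psi_Q,\phi\rangle\,d\tau_{1+n})$ denotes the set of sequences $a$ with $\int_{\mathcal Q}|a_Q||\langle\psi_Q,\phi\rangle|\,d\tau_{1+n}<\infty$. *)

theory Defs
  imports "HOL-Analysis.Analysis"
begin

text \<open>Euclidean $n$-space is \<open>real ^ 'n\<close>, with \<open>n = CARD('n) \<ge> 1\<close>.\<close>

section \<open>Schwartz functions\<close>

definition partial_derivative ::
    "'n::finite \<Rightarrow> (real ^ 'n \<Rightarrow> complex) \<Rightarrow> real ^ 'n \<Rightarrow> complex" where
  "partial_derivative i f x = frechet_derivative f (at x) (axis i 1)"

text \<open>A derivative of order \<open>m\<close> is given by the list, of length \<open>m\<close>, of the coordinates to
  differentiate in. All lists are admitted: mixed derivatives of a smooth function commute, so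
  every $D^\beta$ occurs, in each order of differentiation.\<close>

definition iterated_derivative ::
    "'n::finite list \<Rightarrow> (real ^ 'n \<Rightarrow> complex) \<Rightarrow> real ^ 'n \<Rightarrow> complex" where
  "iterated_derivative is f = foldr partial_derivative is f"

definition smooth :: "(real ^ 'n::finite \<Rightarrow> complex) \<Rightarrow> bool" where
  "smooth f \<longleftrightarrow> (\<forall>is x. iterated_derivative is f differentiable (at x))"

definition monomial :: "('n::finite \<Rightarrow> nat) \<Rightarrow> real ^ 'n \<Rightarrow> real" where
  "monomial \<alpha> x = (\<Prod>i\<in>UNIV. (x $ i) ^ \<alpha> i)"

definition schwartz_space :: "(real ^ 'n::finite \<Rightarrow> complex) set" where
  "schwartz_space = {f. smooth f \<and>
     (\<forall>\<alpha> is. bounded (range (\<lambda>x. of_real (monomial \<alpha> x) * iterated_derivative is f x)))}"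

definition schwartz_seminorm ::
    "('n::finite \<Rightarrow> nat) \<Rightarrow> 'n list \<Rightarrow> (real ^ 'n \<Rightarrow> complex) \<Rightarrow> real" where
  "schwartz_seminorm \<alpha> is f = (SUP x. norm (of_real (monomial \<alpha> x) * iterated_derivative is f x))"

definition schwartz_topology :: "(real ^ 'n::finite \<Rightarrow> complex) topology" where
  "schwartz_topology = topology_generated_by
     {{g \<in> schwartz_space. schwartz_seminorm \<alpha> is (\<lambda>x. g x - f x) < \<epsilon>} | f \<alpha> is \<epsilon>.
        f \<in> schwartz_space \<and> 0 < \<epsilon>}"


section \<open>The space of Schwartz functions with vanishing moments and its dual\<close>

definition pairing :: "(real ^ 'n::finite \<Rightarrow> complex) \<Rightarrow> (real ^ 'n \<Rightarrow> complex) \<Rightarrow> complex" where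
  "pairing f \<phi> = (LINT x|lborel. f x * cnj (\<phi> x))"

definition Z_space :: "(real ^ 'n::finite \<Rightarrow> complex) set" where
  "Z_space = {\<phi> \<in> schwartz_space. \<forall>\<alpha>. (LINT x|lborel. of_real (monomial \<alpha> x) * \<phi> x) = 0}"

definition Z_topology :: "(real ^ 'n::finite \<Rightarrow> complex) topology" where
  "Z_topology = subtopology schwartz_topology Z_space"

text \<open>The dual $\mathcal{Z}'$. As pairings are anti-linear in the second slot, an element \<open>u\<close> of the
  dual is the continuous anti-linear functional $\phi \mapsto \langle u, \phi\rangle$. Functionals
  are extensional, so that equality in the dual is equality of functions. The quotient
  $\mathcal{S}'/\mathcal{P}$ is identified with the dual by restricting tempered distributions
  to \<^const>\<open>Z_space\<close>, which annihilates exactly the polynomials.\<close>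

definition Z_dual :: "((real ^ 'n::finite \<Rightarrow> complex) \<Rightarrow> complex) set" where
  "Z_dual = {u \<in> extensional Z_space.
     (\<forall>\<phi>\<in>Z_space. \<forall>\<eta>\<in>Z_space. u (\<lambda>x. \<phi> x + \<eta> x) = u \<phi> + u \<eta>) \<and>
     (\<forall>c. \<forall>\<phi>\<in>Z_space. u (\<lambda>x. c * \<phi> x) = cnj c * u \<phi>) \<and>
     continuous_map Z_topology euclidean u}"

text \<open>The w*-topology is that of pointwise convergence on \<^const>\<open>Z_space\<close>, inherited from the
  product of copies of the complex plane.\<close>

definition Z_dual_weak_star :: "((real ^ 'n::finite \<Rightarrow> complex) \<Rightarrow> complex) topology" where
  "Z_dual_weak_star = subtopology (product_topology (\<lambda>_. euclidean) Z_space) Z_dual"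

text \<open>The class in $\mathcal{Z}' = \mathcal{S}'/\mathcal{P}$ of (the distribution given by) \<open>f\<close>.\<close>

definition Z_class :: "(real ^ 'n::finite \<Rightarrow> complex) \<Rightarrow> (real ^ 'n \<Rightarrow> complex) \<Rightarrow> complex" where
  "Z_class f = (\<lambda>\<phi>\<in>Z_space. pairing f \<phi>)"


section \<open>Admissible functions\<close>

definition fourier_transform :: "(real ^ 'n::finite \<Rightarrow> complex) \<Rightarrow> real ^ 'n \<Rightarrow> complex" where
  "fourier_transform f \<xi> = (LINT x|lborel. exp (- \<i> * of_real (x \<bullet> \<xi>)) * f x)"

text \<open>\<open>K\<^sub>0 < K\<^sub>1\<close> are the constants with lower indices, \<open>L\<^sub>1 < L\<^sub>0\<close> those with upper indices:
  \<open>L\<^sub>1\<close> is $K^1$ and \<open>L\<^sub>0\<close> is $K^0$.\<close>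

definition admissible_constants :: "real \<Rightarrow> real \<Rightarrow> real \<Rightarrow> real \<Rightarrow> bool" where
  "admissible_constants K\<^sub>0 K\<^sub>1 L\<^sub>1 L\<^sub>0 \<longleftrightarrow>
     0 < K\<^sub>0 \<and> K\<^sub>0 < K\<^sub>1 \<and> K\<^sub>1 < 1 \<and> 1 < L\<^sub>1 \<and> L\<^sub>1 < L\<^sub>0 \<and> 2 * K\<^sub>1 < L\<^sub>1 \<and> L\<^sub>0 < pi"

definition admissible ::
    "real \<Rightarrow> real \<Rightarrow> real \<Rightarrow> real \<Rightarrow> (real ^ 'n::finite \<Rightarrow> complex) \<Rightarrow> bool" where
  "admissible K\<^sub>0 K\<^sub>1 L\<^sub>1 L\<^sub>0 \<psi> \<longleftrightarrow> \<psi> \<in> schwartz_space \<and>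
     closure {\<xi>. fourier_transform \<psi> \<xi> \<noteq> 0} \<subseteq> {\<xi>. K\<^sub>0 \<le> norm \<xi> \<and> norm \<xi> \<le> L\<^sub>0} \<and>
     (\<exists>c>0. \<forall>\<xi>. K\<^sub>1 \<le> norm \<xi> \<and> norm \<xi> \<le> L\<^sub>1 \<longrightarrow> c \<le> norm (fourier_transform \<psi> \<xi>))"


section \<open>Dyadic cubes and sequences\<close>

text \<open>The dyadic cube $Q_{\nu k}$ is represented by its index \<open>(\<nu>, k)\<close>; this is legitimate by
  \<open>inj_dyadic_cube\<close> below.\<close>

type_synonym 'n dyadic = "int \<times> (int ^ 'n)"

definition dyadic_cube :: "'n::finite dyadic \<Rightarrow> (real ^ 'n) set" where
  "dyadic_cube = (\<lambda>(\<nu>, k). {x. \<forall>i. of_int (k $ i) \<le> 2 powi \<nu> * x $ i \<and>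
                                    2 powi \<nu> * x $ i < of_int (k $ i) + 1})"

lemma inj_dyadic_cube: "inj (dyadic_cube :: 'n::finite dyadic \<Rightarrow> _)"
proof -
  have corner: "of_int (l $ i) / 2 powi \<mu> \<le> (of_int (k $ i) / 2 powi \<nu> :: real)"
    if "dyadic_cube (\<nu>, k) = dyadic_cube (\<mu>, l)" for \<nu> \<mu> and k l :: "int ^ 'n" and i
  proof -
    have "(\<chi> i. of_int (k $ i) / 2 powi \<nu>) \<in> dyadic_cube (\<nu>, k)"
      by (simp add: dyadic_cube_def)
    then have "(\<chi> i. of_int (k $ i) / 2 powi \<nu>) \<in> dyadic_cube (\<mu>, l)"
      using that by simp
    then show ?thesis
      by (simp add: dyadic_cube_def field_simps)
  qed
  have scale: "\<mu> \<le> \<nu>"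
    if eq: "dyadic_cube (\<nu>, k) = dyadic_cube (\<mu>, l)" for \<nu> \<mu> and k l :: "int ^ 'n"
  proof (rule ccontr)
    assume "\<not> \<mu> \<le> \<nu>"
    then have lt: "(2::real) powi \<nu> < 2 powi \<mu>"
      by (intro power_int_strict_increasing) auto
    let ?x = "\<chi> i. (of_int (k $ i) / 2 powi \<nu> + 1 / 2 powi \<mu> :: real)"
    have "?x \<in> dyadic_cube (\<nu>, k)"
      using lt by (simp add: dyadic_cube_def distrib_left)
    then have "?x \<in> dyadic_cube (\<mu>, l)"
      using eq by simp
    then have "2 powi \<mu> * (of_int (k $ i) / 2 powi \<nu> + 1 / 2 powi \<mu>) < (of_int (l $ i) + 1 :: real)" for i
      by (simp add: dyadic_cube_def)
    moreover have "of_int (l $ i) / 2 powi \<mu> = (of_int (k $ i) / 2 powi \<nu> :: real)" for i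
      using corner[OF eq, of i] corner[OF eq[symmetric], of i] by simp
    ultimately have "2 powi \<mu> * (of_int (l $ i) / 2 powi \<mu> + 1 / 2 powi \<mu>) < (of_int (l $ i) + 1 :: real)" for i
      by simp
    then show False
      by (simp add: distrib_left)
  qed
  have "\<nu> = \<mu> \<and> k = l"
    if eq: "dyadic_cube (\<nu>, k) = dyadic_cube (\<mu>, l)" for \<nu> \<mu> and k l :: "int ^ 'n"
  proof -
    have \<nu>: "\<nu> = \<mu>"
      using scale[OF eq] scale[OF eq[symmetric]] by simp
    moreover have "k $ i = l $ i" for i
      using corner[OF eq, of i] corner[OF eq[symmetric], of i] \<nu>
      by (simp add: divide_le_cancel)
    ultimately show ?thesis
      by (simp add: vec_eq_iff)
  qed
  then show ?thesis
    by (auto intro!: injI)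
qed

definition dyadic_dilate ::
    "(real ^ 'n::finite \<Rightarrow> complex) \<Rightarrow> 'n dyadic \<Rightarrow> real ^ 'n \<Rightarrow> complex" where
  "dyadic_dilate \<psi> = (\<lambda>(\<nu>, k) x. of_real (2 powr (real CARD('n) * of_int \<nu> / 2)) *
     \<psi> (2 powi \<nu> *\<^sub>R x - (\<chi> i. of_int (k $ i))))"

definition L1_sequences ::
    "(real ^ 'n::finite \<Rightarrow> complex) \<Rightarrow> (real ^ 'n \<Rightarrow> complex) \<Rightarrow> ('n dyadic \<Rightarrow> complex) set" where
  "L1_sequences \<psi> \<phi> = {a.
     (\<integral>\<^sup>+ Q. ennreal (norm (a Q) * norm (pairing (dyadic_dilate \<psi> Q) \<phi>)) \<partial>count_space UNIV) < \<infinity>}"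

definition synthesis_domain ::
    "(real ^ 'n::finite \<Rightarrow> complex) \<Rightarrow> ('n dyadic \<Rightarrow> complex) set" where
  "synthesis_domain \<psi> = (\<Inter>\<phi>\<in>Z_space. L1_sequences \<psi> \<phi>)"

text \<open>\<open>T\<close>, as a map into $\mathcal{Z}'$, extends $a \mapsto \sum_Q a_Q \psi_Q$ from the sequences of
  finite support. The values of \<open>T\<close> off \<^const>\<open>synthesis_domain\<close> are immaterial.\<close>

definition extends_synthesis ::
    "(real ^ 'n::finite \<Rightarrow> complex) \<Rightarrow>
     (('n dyadic \<Rightarrow> complex) \<Rightarrow> (real ^ 'n \<Rightarrow> complex) \<Rightarrow> complex) \<Rightarrow> bool" where
  "extends_synthesis \<psi> T \<longleftrightarrow> T \<in> synthesis_domain \<psi> \<rightarrow> Z_dual \<and>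
     (\<forall>a. finite {Q. a Q \<noteq> 0} \<longrightarrow> a \<in> synthesis_domain \<psi> \<and>
        T a = Z_class (\<lambda>x. \<Sum>Q | a Q \<noteq> 0. a Q * dyadic_dilate \<psi> Q x))"

definition synthesis_linear ::
    "(real ^ 'n::finite \<Rightarrow> complex) \<Rightarrow>
     (('n dyadic \<Rightarrow> complex) \<Rightarrow> (real ^ 'n \<Rightarrow> complex) \<Rightarrow> complex) \<Rightarrow> bool" where
  "synthesis_linear \<psi> T \<longleftrightarrow>
     (\<forall>a\<in>synthesis_domain \<psi>. \<forall>b\<in>synthesis_domain \<psi>. \<forall>c d.
        (\<lambda>Q. c * a Q + d * b Q) \<in> synthesis_domain \<psi> \<and>
        T (\<lambda>Q. c * a Q + d * b Q) = (\<lambda>\<phi>\<in>Z_space. c * T a \<phi> + d * T b \<phi>))"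

definition truncation_limits ::
    "(real ^ 'n::finite \<Rightarrow> complex) \<Rightarrow>
     (('n dyadic \<Rightarrow> complex) \<Rightarrow> (real ^ 'n \<Rightarrow> complex) \<Rightarrow> complex) \<Rightarrow> bool" where
  "truncation_limits \<psi> T \<longleftrightarrow>
     (\<forall>a\<in>synthesis_domain \<psi>. \<forall>S :: nat \<Rightarrow> 'n dyadic set.
        (\<forall>m. finite (S m)) \<and> incseq S \<and> {Q. a Q \<noteq> 0} \<subseteq> (\<Union>m. S m) \<longrightarrow>
        limitin Z_dual_weak_star (\<lambda>m. T (\<lambda>Q. indicator (S m) Q * a Q)) (T a) sequentially)"

end

theory Submission imports Defs "HOL-Probability.Sinc_Integral" begin

text \<open>For a fixed sequence the series $\phi \mapsto \sum_Q a_Q \langle\psi_Q, \phi\rangle$ is the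
  pointwise limit on $\mathcal{Z}$ of its finite partial sums, which are continuous functionals because
  each $\psi_Q$ is bounded. Since $\mathcal{Z}$ is a Frechet space, the uniform boundedness principle
  makes the limit continuous. The remaining assertions follow from dominated convergence on the countable
  set of cubes.\<close>

section \<open>Schwartz functions\<close>

text \<open>Membership in \<open>synthesis_domain\<close> gives absolute convergence for each test
  function separately, with no estimate uniform in the test function, so continuity of the sum has
  to be extracted from completeness. Completeness is proved from the definitions: uniform limits of
  all derivatives handle the Schwartz space, and the vanishing-moment functions are closed in it
  because every moment is controlled by finitely many seminorms. The same estimate with exponent
  zero bounds the L1 norm of a test function, hence its pairing with a bounded function. The
  category argument uses balls indexed by a single natural number, so that nested neighbourhoods
  become an increasing sequence of numbers. Uniqueness holds because truncations have finite
  support, where any two extensions agree.\<close>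

lemma partial_derivative_eq:
  "(f has_derivative F) (at x) \<Longrightarrow> partial_derivative i f x = F (axis i 1)"
  unfolding partial_derivative_def by (metis frechet_derivative_at)

lemma iterated_derivative_Nil [simp]: "iterated_derivative [] f = f"
  by (simp add: iterated_derivative_def)

lemma iterated_derivative_Cons [simp]:
  "iterated_derivative (i # is) f = partial_derivative i (iterated_derivative is f)"
  by (simp add: iterated_derivative_def)

text \<open>Linearity and the expansion of \<open>h\<close> in the standard basis. In this form
  bounds on finitely many scalar functions control the whole derivative.\<close>

lemma has_derivative_partial_derivative:
  fixes f :: "real ^ 'n::finite \<Rightarrow> complex"
  assumes "f differentiable (at x)"
  shows "(f has_derivative (\<lambda>h. \<Sum>i\<in>UNIV. h $ i *\<^sub>R partial_derivative i f x)) (at x)"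
proof -
  let ?F = "frechet_derivative f (at x)"
  have F: "(f has_derivative ?F) (at x)"
    using assms frechet_derivative_works by blast
  then have lin: "linear ?F"
    by (rule has_derivative_linear)
  have "?F h = (\<Sum>i\<in>UNIV. h $ i *\<^sub>R partial_derivative i f x)" for h
  proof -
    have "?F h = ?F (\<Sum>i\<in>UNIV. h $ i *\<^sub>R axis i 1)"
      by (simp add: basis_expansion flip: scalar_mult_eq_scaleR)
    also have "\<dots> = (\<Sum>i\<in>UNIV. h $ i *\<^sub>R partial_derivative i f x)"
      using lin by (simp add: linear_sum linear_cmul partial_derivative_def)
    finally show ?thesis .
  qed
  then show ?thesis
    using F by (metis (no_types, lifting) ext)
qed

lemma iterated_derivative_lincomb:
  assumes "smooth f" "smooth g"
  shows "iterated_derivative is (\<lambda>x. c * f x + d * g x) =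
    (\<lambda>x. c * iterated_derivative is f x + d * iterated_derivative is g x)"
proof (induction "is")
  case Nil
  show ?case by simp
next
  case (Cons i "is")
  have "partial_derivative i (\<lambda>x. c * iterated_derivative is f x + d * iterated_derivative is g x) x =
     c * partial_derivative i (iterated_derivative is f) x +
     d * partial_derivative i (iterated_derivative is g) x" for x
  proof -
    from assms have
      "(iterated_derivative is f has_derivative frechet_derivative (iterated_derivative is f) (at x)) (at x)"
      "(iterated_derivative is g has_derivative frechet_derivative (iterated_derivative is g) (at x)) (at x)"
      by (simp_all add: smooth_def flip: frechet_derivative_works)
    from partial_derivative_eq[OF has_derivative_add[OF has_derivative_mult_right[OF this(1)]
         has_derivative_mult_right[OF this(2)]]]
    show ?thesis
      by (simp add: partial_derivative_def)
  qed
  then show ?case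
    by (simp add: Cons fun_eq_iff)
qed

lemma smooth_lincomb:
  assumes "smooth f" "smooth g"
  shows "smooth (\<lambda>x. c * f x + d * g x)"
  using assms unfolding smooth_def
  by (auto simp: iterated_derivative_lincomb[unfolded smooth_def, OF assms[unfolded smooth_def]])

lemma smooth_imp_continuous_on: "smooth f \<Longrightarrow> continuous_on A (iterated_derivative is f)"
  unfolding smooth_def
  by (meson continuous_at_imp_continuous_on differentiable_imp_continuous_within)

text \<open>The family \<open>g\<close> lists candidate limits for all orders at once. Uniform
  convergence at the orders \<open>i # is\<close> is uniform convergence of the Frechet derivatives
  at order \<open>is\<close>, so the limit there may be differentiated term by term; induction then
  identifies \<open>g is\<close> as a derivative of \<open>g []\<close>.\<close>

lemma iterated_derivative_uniform_limit:
  fixes f :: "nat \<Rightarrow> real ^ 'n::finite \<Rightarrow> complex"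
  assumes smooth: "\<And>m. smooth (f m)"
    and lim: "\<And>is. uniform_limit UNIV (\<lambda>m. iterated_derivative is (f m)) (g is) sequentially"
  shows "smooth (g [])" "iterated_derivative is (g []) = g is"
proof -
  have der: "(g is has_derivative (\<lambda>h. \<Sum>i\<in>UNIV. h $ i *\<^sub>R g (i # is) x)) (at x)" for "is" x
  proof -
    define D where "D m x = (\<lambda>h. \<Sum>i\<in>UNIV. h $ i *\<^sub>R iterated_derivative (i # is) (f m) x)" for m x
    define D' where "D' x = (\<lambda>h. \<Sum>i\<in>UNIV. h $ i *\<^sub>R g (i # is) x)" for x
    have D: "(iterated_derivative is (f m) has_derivative D m x) (at x within UNIV)" for m x
      using has_derivative_partial_derivative smooth[of m] unfolding D_def smooth_def by auto
    have close: "\<forall>\<^sub>F m in sequentially. \<forall>x\<in>UNIV. \<forall>h. norm (D m x h - D' x h) \<le> e * norm h"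
      if "e > 0" for e
    proof -
      define d where "d = e / real CARD('n)"
      have "d > 0"
        using that by (simp add: d_def)
      then have "\<forall>\<^sub>F m in sequentially. \<forall>x\<in>UNIV.
          dist (iterated_derivative (i # is) (f m) x) (g (i # is) x) < d" for i
        using lim[of "i # is"] unfolding uniform_limit_iff by blast
      then have "\<forall>\<^sub>F m in sequentially. \<forall>i. \<forall>x\<in>UNIV.
          dist (iterated_derivative (i # is) (f m) x) (g (i # is) x) < d"
        by (rule eventually_all_finite)
      then show ?thesis
      proof eventually_elim
        case (elim m)
        show ?case
        proof (intro ballI allI)
          fix x h
          have "norm (D m x h - D' x h) =
              norm (\<Sum>i\<in>UNIV. h $ i *\<^sub>R (iterated_derivative (i # is) (f m) x - g (i # is) x))"
            by (simp add: D_def D'_def sum_subtractf scaleR_diff_right)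
          also have "\<dots> \<le> (\<Sum>i\<in>(UNIV::'n set). norm h * d)"
            using elim \<open>d > 0\<close> by (intro sum_norm_le)
              (auto simp: dist_norm less_imp_le intro!: mult_mono component_le_norm_cart)
          also have "\<dots> = e * norm h"
            by (simp add: d_def)
          finally show "norm (D m x h - D' x h) \<le> e * norm h" .
        qed
      qed
    qed
    have pt: "(\<lambda>m. iterated_derivative is (f m) y) \<longlonglongrightarrow> g is y" for y
      using lim by (rule tendsto_uniform_limitI) simp
    \<comment> \<open>\<open>has_derivative_sequence\<close> asks for convergence at one point only,
      here \<open>0\<close>, and yields its own limit \<open>G\<close>, still to be identified with
      \<open>g is\<close>.\<close>
    have "\<exists>G. \<forall>x\<in>UNIV. (\<lambda>m. iterated_derivative is (f m) x) \<longlonglongrightarrow> G x \<and>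
        (G has_derivative D' x) (at x within UNIV)"
      using has_derivative_sequence[OF convex_UNIV D close UNIV_I pt[of 0]] by blast
    then obtain G where G: "\<And>x. (\<lambda>m. iterated_derivative is (f m) x) \<longlonglongrightarrow> G x"
        "\<And>x. (G has_derivative D' x) (at x)"
      by auto
    have "G = g is"
      using LIMSEQ_unique[OF G(1) pt] by auto
    then show ?thesis
      using G(2)[of x] by (simp add: D'_def)
  qed
  have eq: "iterated_derivative is (g []) = g is" for "is"
  proof (induction "is")
    case (Cons i "is")
    have "partial_derivative i (g is) x = g (i # is) x" for x
    proof -
      have "partial_derivative i (g is) x = (\<Sum>j\<in>UNIV. axis i 1 $ j *\<^sub>R g (j # is) x)"
        by (rule partial_derivative_eq[OF der])
      also have "\<dots> = (\<Sum>j\<in>UNIV. if j = i then g (i # is) x else 0)"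
        by (intro sum.cong) (auto simp: axis_def)
      finally show ?thesis by simp
    qed
    with Cons show ?case by auto
  qed auto
  show "smooth (g [])"
    unfolding smooth_def eq using der differentiableI by blast
  show "iterated_derivative is (g []) = g is"
    by (rule eq)
qed

text \<open>A supremum of reals bounds its members only when they are bounded above; this is the
  role of the membership premise.\<close>

lemma schwartz_space_bound:
  assumes "f \<in> schwartz_space"
  shows "norm (of_real (monomial \<alpha> x) * iterated_derivative is f x) \<le> schwartz_seminorm \<alpha> is f"
proof -
  have "bounded (range (\<lambda>x. norm (of_real (monomial \<alpha> x) * iterated_derivative is f x)))"
    using assms unfolding schwartz_space_def bounded_iff by auto
  then show ?thesis
    unfolding schwartz_seminorm_def
    by (intro cSUP_upper) (auto intro: bounded_imp_bdd_above)
qed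

lemma schwartz_seminorm_le:
  "(\<And>x. norm (of_real (monomial \<alpha> x) * iterated_derivative is f x) \<le> C) \<Longrightarrow>
   schwartz_seminorm \<alpha> is f \<le> C"
  unfolding schwartz_seminorm_def by (intro cSUP_least) auto

lemma schwartz_seminorm_nonneg: "f \<in> schwartz_space \<Longrightarrow> 0 \<le> schwartz_seminorm \<alpha> is f"
  by (rule order_trans[OF norm_ge_zero schwartz_space_bound])

lemma schwartz_space_smooth: "f \<in> schwartz_space \<Longrightarrow> smooth f"
  by (simp add: schwartz_space_def)

lemma schwartz_spaceI:
  assumes "smooth f"
    and "\<And>\<alpha> is x. norm (of_real (monomial \<alpha> x) * iterated_derivative is f x) \<le> C \<alpha> is"
  shows "f \<in> schwartz_space"
  using assms unfolding schwartz_space_def bounded_iff by auto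

lemma schwartz_lincomb_bound:
  assumes "f \<in> schwartz_space" "g \<in> schwartz_space"
  shows "norm (of_real (monomial \<alpha> x) * iterated_derivative is (\<lambda>x. c * f x + d * g x) x)
     \<le> norm c * schwartz_seminorm \<alpha> is f + norm d * schwartz_seminorm \<alpha> is g"
proof -
  have "norm (of_real (monomial \<alpha> x) * iterated_derivative is (\<lambda>x. c * f x + d * g x) x) =
    norm (c * (of_real (monomial \<alpha> x) * iterated_derivative is f x) +
          d * (of_real (monomial \<alpha> x) * iterated_derivative is g x))"
    using assms by (simp add: iterated_derivative_lincomb schwartz_space_smooth algebra_simps)
  also have "\<dots> \<le> norm c * norm (of_real (monomial \<alpha> x) * iterated_derivative is f x) +
      norm d * norm (of_real (monomial \<alpha> x) * iterated_derivative is g x)"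
    by (metis norm_mult norm_triangle_ineq)
  also have "\<dots> \<le> norm c * schwartz_seminorm \<alpha> is f + norm d * schwartz_seminorm \<alpha> is g"
    by (intro add_mono mult_left_mono schwartz_space_bound assms) auto
  finally show ?thesis .
qed

lemma schwartz_space_lincomb:
  "f \<in> schwartz_space \<Longrightarrow> g \<in> schwartz_space \<Longrightarrow> (\<lambda>x. c * f x + d * g x) \<in> schwartz_space"
  by (rule schwartz_spaceI[OF smooth_lincomb schwartz_lincomb_bound])
    (auto intro: schwartz_space_smooth)

lemma schwartz_seminorm_lincomb:
  "f \<in> schwartz_space \<Longrightarrow> g \<in> schwartz_space \<Longrightarrow>
   schwartz_seminorm \<alpha> is (\<lambda>x. c * f x + d * g x)
     \<le> norm c * schwartz_seminorm \<alpha> is f + norm d * schwartz_seminorm \<alpha> is g"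
  by (rule schwartz_seminorm_le[OF schwartz_lincomb_bound])

lemma schwartz_space_diff:
  "f \<in> schwartz_space \<Longrightarrow> g \<in> schwartz_space \<Longrightarrow> (\<lambda>x. f x - g x) \<in> schwartz_space"
  using schwartz_space_lincomb[of f g 1 "-1"] by simp

lemma schwartz_seminorm_diff_triangle:
  assumes "f \<in> schwartz_space" "g \<in> schwartz_space" "h \<in> schwartz_space"
  shows "schwartz_seminorm \<alpha> is (\<lambda>x. f x - h x) \<le>
    schwartz_seminorm \<alpha> is (\<lambda>x. f x - g x) + schwartz_seminorm \<alpha> is (\<lambda>x. g x - h x)"
  using schwartz_seminorm_lincomb[of "\<lambda>x. f x - g x" "\<lambda>x. g x - h x" \<alpha> "is" 1 1] assms
  by (simp add: schwartz_space_diff)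

lemma iterated_derivative_diff:
  assumes "f \<in> schwartz_space" "g \<in> schwartz_space"
  shows "iterated_derivative is (\<lambda>x. f x - g x) x = iterated_derivative is f x - iterated_derivative is g x"
  using iterated_derivative_lincomb[of f g "is" 1 "-1"] assms by (simp add: schwartz_space_smooth)

text \<open>Seminorms with exponent zero are sup norms of derivatives, so every derivative converges
  uniformly; the weighted bounds then pass to the limit pointwise. The second conclusion is
  quantitative: a bound for the tail differences is inherited with the same constant, as the
  explicit radii of the nested balls require.\<close>

lemma schwartz_space_complete:
  fixes f :: "nat \<Rightarrow> real ^ 'n::finite \<Rightarrow> complex"
  assumes f: "\<And>m. f m \<in> schwartz_space"
    and Cauchy: "\<And>\<alpha> is e. e > 0 \<Longrightarrow>
      \<exists>M. \<forall>m\<ge>M. \<forall>n\<ge>M. schwartz_seminorm \<alpha> is (\<lambda>x. f m x - f n x) < e"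
  obtains g where "g \<in> schwartz_space"
    "\<And>\<alpha> is m e. (\<And>n. n \<ge> m \<Longrightarrow> schwartz_seminorm \<alpha> is (\<lambda>x. f n x - f m x) \<le> e) \<Longrightarrow>
      schwartz_seminorm \<alpha> is (\<lambda>x. g x - f m x) \<le> e"
proof -
  have mono0: "monomial (\<lambda>_. 0) x = 1" for x :: "real ^ 'n"
    by (simp add: monomial_def)
  have "\<exists>G. uniform_limit UNIV (\<lambda>m. iterated_derivative is (f m)) G sequentially" for "is"
  proof -
    have "uniformly_Cauchy_on UNIV (\<lambda>m. iterated_derivative is (f m))"
    proof (rule uniformly_Cauchy_onI)
      fix e :: real assume "e > 0"
      then obtain M where M: "\<forall>m\<ge>M. \<forall>n\<ge>M. schwartz_seminorm (\<lambda>_. 0) is (\<lambda>x. f m x - f n x) < e"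
        using Cauchy by blast
      have "dist (iterated_derivative is (f m) x) (iterated_derivative is (f n) x) < e"
        if "m \<ge> M" "n \<ge> M" for m n x
      proof -
        have "dist (iterated_derivative is (f m) x) (iterated_derivative is (f n) x) =
           norm (of_real (monomial (\<lambda>_. 0) x) * iterated_derivative is (\<lambda>x. f m x - f n x) x)"
          by (simp add: mono0 dist_norm iterated_derivative_diff f)
        also have "\<dots> \<le> schwartz_seminorm (\<lambda>_. 0) is (\<lambda>x. f m x - f n x)"
          by (intro schwartz_space_bound schwartz_space_diff f)
        also have "\<dots> < e"
          using M that by blast
        finally show ?thesis .
      qed
      then show "\<exists>M. \<forall>x\<in>UNIV. \<forall>m\<ge>M. \<forall>n\<ge>M.
          dist (iterated_derivative is (f m) x) (iterated_derivative is (f n) x) < e"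
        by blast
    qed
    then show ?thesis
      using Cauchy_uniformly_convergent uniformly_convergent_on_def by blast
  qed
  then obtain G where G: "\<And>is. uniform_limit UNIV (\<lambda>m. iterated_derivative is (f m)) (G is) sequentially"
    by metis
  note g = iterated_derivative_uniform_limit[OF schwartz_space_smooth[OF f] G]
  \<comment> \<open>For fixed \<open>x\<close> the inequality for \<open>f n\<close>,
    \<open>n \<ge> m\<close>, is a closed condition, so it survives as \<open>n\<close> tends to
    infinity.\<close>
  have close: "norm (of_real (monomial \<alpha> x) * (G is x - iterated_derivative is (f m) x)) \<le> e"
    if "\<And>n. n \<ge> m \<Longrightarrow> schwartz_seminorm \<alpha> is (\<lambda>x. f n x - f m x) \<le> e" for \<alpha> "is" m e x
  proof (rule tendsto_upperbound)
    have "(\<lambda>n. iterated_derivative is (f n) x) \<longlonglongrightarrow> G is x"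
      using G by (rule tendsto_uniform_limitI) simp
    then show "(\<lambda>n. norm (of_real (monomial \<alpha> x) * (iterated_derivative is (f n) x - iterated_derivative is (f m) x)))
        \<longlonglongrightarrow> norm (of_real (monomial \<alpha> x) * (G is x - iterated_derivative is (f m) x))"
      by (intro tendsto_intros)
    have "norm (of_real (monomial \<alpha> x) * (iterated_derivative is (f n) x - iterated_derivative is (f m) x)) \<le> e"
      if "n \<ge> m" for n
      using schwartz_space_bound[OF schwartz_space_diff[OF f f], of \<alpha> x "is" n m]
        \<open>\<And>n. n \<ge> m \<Longrightarrow> _\<close>[OF that] by (simp add: iterated_derivative_diff f)
    then show "\<forall>\<^sub>F n in sequentially. norm (of_real (monomial \<alpha> x) *
        (iterated_derivative is (f n) x - iterated_derivative is (f m) x)) \<le> e"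
      using eventually_sequentially by blast
  qed simp
  have S: "G [] \<in> schwartz_space"
  proof -
    have "\<exists>C. \<forall>x. norm (of_real (monomial \<alpha> x) * G is x) \<le> C" for \<alpha> "is"
    proof -
      obtain M where M: "\<And>n. n \<ge> M \<Longrightarrow> schwartz_seminorm \<alpha> is (\<lambda>x. f n x - f M x) \<le> 1"
        using Cauchy[of 1 \<alpha> "is"] by (metis less_imp_le order_refl zero_less_one)
      have "norm (of_real (monomial \<alpha> x) * G is x) \<le> 1 + schwartz_seminorm \<alpha> is (f M)" for x
      proof -
        have "norm (of_real (monomial \<alpha> x) * G is x) =
          norm (of_real (monomial \<alpha> x) * (G is x - iterated_derivative is (f M) x) +
                of_real (monomial \<alpha> x) * iterated_derivative is (f M) x)"
          by (simp add: algebra_simps)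
        also have "\<dots> \<le> 1 + schwartz_seminorm \<alpha> is (f M)"
          by (intro norm_triangle_le add_mono close[OF M] schwartz_space_bound f)
        finally show ?thesis .
      qed
      then show ?thesis by blast
    qed
    then obtain C where "\<And>\<alpha> is x. norm (of_real (monomial \<alpha> x) * G is x) \<le> C \<alpha> is"
      by metis
    then show ?thesis
      by (intro schwartz_spaceI[of _ C]) (auto simp: g)
  qed
  show ?thesis
  proof (rule that[OF S])
    show "schwartz_seminorm \<alpha> is (\<lambda>x. G [] x - f m x) \<le> e"
      if "\<And>n. n \<ge> m \<Longrightarrow> schwartz_seminorm \<alpha> is (\<lambda>x. f n x - f m x) \<le> e" for \<alpha> "is" m e
      using close[OF that] by (intro schwartz_seminorm_le) (simp add: iterated_derivative_diff S f g)
  qed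
qed

section \<open>Integrability and vanishing moments\<close>

lemma nn_integral_inverse_1_plus_square_finite:
  "(\<integral>\<^sup>+ x. ennreal (inverse (1 + x\<^sup>2)) \<partial>lborel) < \<infinity>"
proof -
  have "integrable lborel (\<lambda>x::real. inverse (1 + x\<^sup>2))"
    using integrable_inverse_1_plus_square by (simp add: set_integrable_def)
  then show ?thesis
    by (subst nn_integral_eq_integral) auto
qed

text \<open>A product of one-dimensional factors rather than a power of the norm: its inverse
  integrates by separation of variables, and it expands into monomials, the weights that occur in
  the seminorms.\<close>

definition decay_weight :: "real ^ 'n::finite \<Rightarrow> real" where
  "decay_weight x = (\<Prod>i\<in>UNIV. 1 + (x $ i)\<^sup>2)"

lemma decay_weight_pos: "decay_weight x > 0"
  unfolding decay_weight_def by (intro prod_pos) (auto intro: add_pos_nonneg)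

lemma continuous_on_decay_weight [continuous_intros]: "continuous_on A decay_weight"
  unfolding decay_weight_def by (intro continuous_intros)

text \<open>Tonelli's theorem splits the integral into one copy of the finite integral of
  \<open>1 / (1 + t^2)\<close> per coordinate.\<close>

lemma integrable_inverse_decay_weight:
  "integrable lborel (\<lambda>x :: real ^ 'n::finite. inverse (decay_weight x))"
proof (rule integrableI_bounded)
  show "(\<lambda>x. inverse (decay_weight x)) \<in> borel_measurable lborel"
    using decay_weight_pos by (auto intro!: borel_measurable_continuous_onI continuous_intros
      simp: less_imp_neq[OF decay_weight_pos, symmetric])
  have "(\<integral>\<^sup>+ x. ennreal (norm (inverse (decay_weight x))) \<partial>(lborel :: (real ^ 'n) measure)) =
     (\<integral>\<^sup>+ x. (\<Prod>b\<in>Basis. ennreal (inverse (1 + (x \<bullet> b)\<^sup>2))) \<partial>(lborel :: (real ^ 'n) measure))"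
  proof (intro nn_integral_cong)
    fix x :: "real ^ 'n"
    have B: "(Basis :: (real ^ 'n) set) = range (\<lambda>i. axis i 1)"
      by (auto simp: Basis_vec_def)
    have "inj (\<lambda>i. axis i 1 :: real ^ 'n)"
      by (auto intro!: injI simp: axis_eq_axis)
    then have "(\<Prod>b\<in>Basis. inverse (1 + (x \<bullet> b)\<^sup>2)) = (\<Prod>i\<in>UNIV. inverse (1 + (x $ i)\<^sup>2))"
      unfolding B by (subst prod.reindex) (auto simp: inner_axis)
    also have "\<dots> = inverse (decay_weight x)"
      by (simp add: decay_weight_def prod_inversef[symmetric])
    finally show "ennreal (norm (inverse (decay_weight x))) =
        (\<Prod>b\<in>Basis. ennreal (inverse (1 + (x \<bullet> b)\<^sup>2)))"
      using decay_weight_pos[of x] by (subst prod_ennreal) auto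
  qed
  also have "\<dots> = (\<Prod>b\<in>(Basis :: (real ^ 'n) set). (\<integral>\<^sup>+ x. ennreal (inverse (1 + x\<^sup>2)) \<partial>lborel))"
    by (rule nn_integral_lborel_prod) auto
  also have "\<dots> < \<infinity>"
    using nn_integral_inverse_1_plus_square_finite
    by (simp add: power_less_top_ennreal)
  finally show "(\<integral>\<^sup>+ x. ennreal (norm (inverse (decay_weight x))) \<partial>(lborel :: (real ^ 'n) measure)) < \<infinity>" .
qed

text \<open>On expanding the product, \<open>X\<close> is the set of coordinates from which the
  square is taken.\<close>

lemma decay_weight_mult_monomial:
  "decay_weight x * monomial \<alpha> x =
     (\<Sum>X\<in>UNIV. monomial (\<lambda>i. \<alpha> i + (if i \<in> X then 2 else 0)) x)"
proof -
  have "decay_weight x = (\<Sum>X\<in>UNIV. (\<Prod>i\<in>X. (x $ i)\<^sup>2))"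
    using prod_add[of UNIV "\<lambda>i. (x $ i)\<^sup>2" "\<lambda>_. 1"] by (simp add: decay_weight_def add.commute)
  moreover have "(\<Prod>i\<in>X. (x $ i)\<^sup>2) * monomial \<alpha> x =
      monomial (\<lambda>i. \<alpha> i + (if i \<in> X then 2 else 0)) x" for X
  proof -
    have "(\<Prod>i\<in>X. (x $ i)\<^sup>2) = (\<Prod>i\<in>UNIV. (x $ i) ^ (if i \<in> X then 2 else 0))"
      by (intro prod.mono_neutral_cong_left) auto
    then show ?thesis
      by (simp add: monomial_def power_add prod.distrib mult.commute)
  qed
  ultimately show ?thesis
    by (simp add: sum_distrib_right)
qed

text \<open>Multiplication by \<open>decay_weight\<close> leaves the integrand bounded by finitely
  many seminorms, so it is dominated by a multiple of the integrable inverse weight. The explicit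
  estimate makes moments, and for \<alpha> = 0 the L1 norm, continuous in the seminorms.\<close>

lemma schwartz_moment_integrable:
  fixes f :: "real ^ 'n::finite \<Rightarrow> complex"
  assumes f: "f \<in> schwartz_space"
  shows "integrable lborel (\<lambda>x. of_real (monomial \<alpha> x) * f x)" (is ?int)
    and "(LINT x|lborel. norm (of_real (monomial \<alpha> x) * f x)) \<le>
      (\<Sum>X\<in>UNIV. schwartz_seminorm (\<lambda>i. \<alpha> i + (if i \<in> X then 2 else 0)) [] f) *
      (LINT x|(lborel :: (real ^ 'n) measure). inverse (decay_weight x))" (is ?le)
proof -
  define C where "C = (\<Sum>X\<in>UNIV. schwartz_seminorm (\<lambda>i. \<alpha> i + (if i \<in> X then 2 else 0)) [] f)"
  have bound: "norm (of_real (monomial \<alpha> x) * f x) \<le> C * inverse (decay_weight x)" for x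
  proof -
    have "decay_weight x * norm (of_real (monomial \<alpha> x) * f x) =
       norm (of_real (decay_weight x * monomial \<alpha> x) * f x)"
      using decay_weight_pos[of x] by (simp add: norm_mult abs_mult)
    also have "\<dots> = norm (\<Sum>X\<in>UNIV. of_real (monomial (\<lambda>i. \<alpha> i + (if i \<in> X then 2 else 0)) x) *
         iterated_derivative [] f x)"
      by (simp add: decay_weight_mult_monomial sum_distrib_right)
    also have "\<dots> \<le> C"
      unfolding C_def by (intro sum_norm_le schwartz_space_bound f)
    finally show ?thesis
      using decay_weight_pos[of x] by (simp add: field_simps)
  qed
  have int: "integrable lborel (\<lambda>x::real^'n. C * inverse (decay_weight x))"
    by (intro integrable_mult_right integrable_inverse_decay_weight)
  have "continuous_on UNIV f"
    using smooth_imp_continuous_on[OF schwartz_space_smooth[OF f], of UNIV "[]"] by simp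
  then have "(\<lambda>x. of_real (monomial \<alpha> x) * f x) \<in> borel_measurable lborel"
    unfolding monomial_def
    by (auto intro!: borel_measurable_continuous_onI continuous_intros)
  then show ?int
    using bound by (intro Bochner_Integration.integrable_bound[OF int])
      (auto simp: order_trans[OF _ abs_ge_self])
  have "(LINT x|lborel. norm (of_real (monomial \<alpha> x) * f x)) \<le>
      (LINT x|(lborel :: (real ^ 'n) measure). C * inverse (decay_weight x))"
    by (intro integral_mono integrable_norm \<open>?int\<close> int bound)
  then show ?le
    by (simp add: C_def)
qed

section \<open>Linear structure and completeness of the space with vanishing moments\<close>

lemma Z_space_schwartz: "\<phi> \<in> Z_space \<Longrightarrow> \<phi> \<in> schwartz_space"
  by (simp add: Z_space_def)

lemma Z_space_lincomb:
  assumes "\<phi> \<in> Z_space" "\<eta> \<in> Z_space"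
  shows "(\<lambda>x. c * \<phi> x + d * \<eta> x) \<in> Z_space"
proof -
  have "(LINT x|lborel. of_real (monomial \<alpha> x) * (c * \<phi> x + d * \<eta> x)) = 0" for \<alpha>
  proof -
    have "integrable lborel (\<lambda>x. of_real (monomial \<alpha> x) * \<phi> x)"
      "integrable lborel (\<lambda>x. of_real (monomial \<alpha> x) * \<eta> x)"
      using assms by (intro schwartz_moment_integrable Z_space_schwartz; simp)+
    note int = this[THEN integrable_mult_right]
    have "(LINT x|lborel. of_real (monomial \<alpha> x) * (c * \<phi> x + d * \<eta> x)) =
      (LINT x|lborel. c * (of_real (monomial \<alpha> x) * \<phi> x) + d * (of_real (monomial \<alpha> x) * \<eta> x))"
      by (simp add: algebra_simps)
    also have "\<dots> = 0"
      using assms by (subst Bochner_Integration.integral_add[OF int]) (auto simp: Z_space_def)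
    finally show ?thesis .
  qed
  then show ?thesis
    using assms by (simp add: Z_space_def schwartz_space_lincomb)
qed

lemma Z_space_diff: "\<phi> \<in> Z_space \<Longrightarrow> \<eta> \<in> Z_space \<Longrightarrow> (\<lambda>x. \<phi> x - \<eta> x) \<in> Z_space"
  using Z_space_lincomb[of \<phi> \<eta> 1 "-1"] by simp

lemma Z_space_scale: "\<phi> \<in> Z_space \<Longrightarrow> (\<lambda>x. c * \<phi> x) \<in> Z_space"
  using Z_space_lincomb[of \<phi> \<phi> c 0] by simp

lemma Z_space_zero: "(\<lambda>x. 0) \<in> Z_space"
proof -
  have "iterated_derivative is (\<lambda>x :: real ^ 'a. 0) = (\<lambda>x. 0)" for "is"
    by (induction "is") (simp_all add: partial_derivative_def)
  then show ?thesis
    by (auto simp: Z_space_def smooth_def intro!: schwartz_spaceI[of _ "\<lambda>_ _. 0"])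
qed

text \<open>Moments depend continuously on the Schwartz function, so the limit supplied by
  \<open>schwartz_space_complete\<close> again has vanishing moments.\<close>

lemma Z_space_complete:
  fixes f :: "nat \<Rightarrow> real ^ 'n::finite \<Rightarrow> complex"
  assumes f: "\<And>m. f m \<in> Z_space"
    and Cauchy: "\<And>\<alpha> is e. e > 0 \<Longrightarrow>
      \<exists>M. \<forall>m\<ge>M. \<forall>n\<ge>M. schwartz_seminorm \<alpha> is (\<lambda>x. f m x - f n x) < e"
  obtains g where "g \<in> Z_space"
    "\<And>\<alpha> is m e. (\<And>n. n \<ge> m \<Longrightarrow> schwartz_seminorm \<alpha> is (\<lambda>x. f n x - f m x) \<le> e) \<Longrightarrow>
      schwartz_seminorm \<alpha> is (\<lambda>x. g x - f m x) \<le> e"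
proof -
  note fS = Z_space_schwartz[OF f]
  obtain g where g: "g \<in> schwartz_space"
    "\<And>\<alpha> is m e. (\<And>n. n \<ge> m \<Longrightarrow> schwartz_seminorm \<alpha> is (\<lambda>x. f n x - f m x) \<le> e) \<Longrightarrow>
      schwartz_seminorm \<alpha> is (\<lambda>x. g x - f m x) \<le> e"
    using schwartz_space_complete[OF fS Cauchy] by blast
  have lim: "(\<lambda>m. schwartz_seminorm \<alpha> is (\<lambda>x. g x - f m x)) \<longlonglongrightarrow> 0" for \<alpha> "is"
  proof (rule LIMSEQ_I)
    fix e :: real assume "e > 0"
    then obtain M where M: "\<forall>m\<ge>M. \<forall>n\<ge>M. schwartz_seminorm \<alpha> is (\<lambda>x. f m x - f n x) < e / 2"
      using Cauchy half_gt_zero by blast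
    have "norm (schwartz_seminorm \<alpha> is (\<lambda>x. g x - f m x) - 0) < e" if "m \<ge> M" for m
    proof -
      have "schwartz_seminorm \<alpha> is (\<lambda>x. g x - f m x) \<le> e / 2"
        using M that by (intro g(2)) (auto intro: less_imp_le)
      then show ?thesis
        using schwartz_seminorm_nonneg[OF schwartz_space_diff[OF g(1) fS]] \<open>e > 0\<close>
        by (simp add: abs_of_nonneg)
    qed
    then show "\<exists>M. \<forall>m\<ge>M. norm (schwartz_seminorm \<alpha> is (\<lambda>x. g x - f m x) - 0) < e"
      by blast
  qed
  have "(LINT x|lborel. of_real (monomial \<alpha> x) * g x) = 0" for \<alpha>
  proof -
    define I where "I = (LINT x|(lborel :: (real ^ 'n) measure). inverse (decay_weight x))"
    have le: "norm (LINT x|lborel. of_real (monomial \<alpha> x) * g x) \<le>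
       (\<Sum>X\<in>UNIV. schwartz_seminorm (\<lambda>i. \<alpha> i + (if i \<in> X then 2 else 0)) [] (\<lambda>x. g x - f m x)) * I" for m
    proof -
      \<comment> \<open>Subtracting the vanishing moment of \<open>f m\<close> turns the moment of
        \<open>g\<close> into that of a small difference.\<close>
      have "(LINT x|lborel. of_real (monomial \<alpha> x) * g x) =
         (LINT x|lborel. of_real (monomial \<alpha> x) * g x) - (LINT x|lborel. of_real (monomial \<alpha> x) * f m x)"
        using f[of m] by (simp add: Z_space_def)
      also have "\<dots> = (LINT x|lborel. of_real (monomial \<alpha> x) * (g x - f m x))"
        unfolding right_diff_distrib
        by (intro Bochner_Integration.integral_diff[symmetric] schwartz_moment_integrable g fS)
      also have "norm \<dots> \<le> (LINT x|lborel. norm (of_real (monomial \<alpha> x) * (g x - f m x)))"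
        by (rule integral_norm_bound)
      also have "\<dots> \<le> (\<Sum>X\<in>UNIV. schwartz_seminorm (\<lambda>i. \<alpha> i + (if i \<in> X then 2 else 0)) []
           (\<lambda>x. g x - f m x)) * I"
        unfolding I_def by (intro schwartz_moment_integrable schwartz_space_diff g fS)
      finally show ?thesis .
    qed
    have "(\<lambda>m. (\<Sum>X\<in>UNIV. schwartz_seminorm (\<lambda>i. \<alpha> i + (if i \<in> X then 2 else 0)) []
           (\<lambda>x. g x - f m x)) * I) \<longlonglongrightarrow> (\<Sum>X\<in>(UNIV :: 'n set set). 0) * I"
      by (intro tendsto_intros lim)
    then have "norm (LINT x|lborel. of_real (monomial \<alpha> x) * g x) \<le> (\<Sum>X\<in>(UNIV :: 'n set set). 0) * I"
      using le by (intro LIMSEQ_le_const) auto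
    then show ?thesis
      by simp
  qed
  then have "g \<in> Z_space"
    using g(1) by (simp add: Z_space_def)
  then show ?thesis
    using that g(2) by blast
qed

section \<open>Uniform boundedness\<close>

text \<open>The radius shrinks while ever more of the countably many seminorms are controlled, so these sets
  form a neighbourhood base at \<open>0\<close>.\<close>

definition Z_ball :: "nat \<Rightarrow> (real ^ 'n::finite \<Rightarrow> complex) set" where
  "Z_ball N = {\<phi> \<in> Z_space. \<forall>\<alpha> is. to_nat (\<alpha>, is) \<le> N \<longrightarrow> schwartz_seminorm \<alpha> is \<phi> \<le> (1/2) ^ N}"

text \<open>Only values on \<open>Z_space\<close> are constrained. The extensionality that
  \<open>Z_dual\<close> demands is left out, so that unrestricted functionals such as
  \<open>pairing f\<close> can qualify.\<close>

definition Z_antilinear :: "((real ^ 'n::finite \<Rightarrow> complex) \<Rightarrow> complex) \<Rightarrow> bool" where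
  "Z_antilinear u \<longleftrightarrow> (\<forall>\<phi>\<in>Z_space. \<forall>\<eta>\<in>Z_space. \<forall>c d.
     u (\<lambda>x. c * \<phi> x + d * \<eta> x) = cnj c * u \<phi> + cnj d * u \<eta>)"

text \<open>Boundedness near \<open>0\<close> is the form of continuity that survives a pointwise
  limit when ball and bound are common to the sequence.\<close>

definition Z_bounded :: "((real ^ 'n::finite \<Rightarrow> complex) \<Rightarrow> complex) \<Rightarrow> bool" where
  "Z_bounded u \<longleftrightarrow> (\<exists>N C. \<forall>\<phi>\<in>Z_ball N. norm (u \<phi>) \<le> C)"

lemma Z_antilinear_diff:
  "Z_antilinear u \<Longrightarrow> \<phi> \<in> Z_space \<Longrightarrow> \<eta> \<in> Z_space \<Longrightarrow> u (\<lambda>x. \<phi> x - \<eta> x) = u \<phi> - u \<eta>"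
  unfolding Z_antilinear_def by (drule bspec[of _ _ \<phi>], simp, drule bspec[of _ _ \<eta>], simp,
    drule spec[of _ 1], drule spec[of _ "-1"]) simp

lemma Z_antilinear_add:
  "Z_antilinear u \<Longrightarrow> \<phi> \<in> Z_space \<Longrightarrow> \<eta> \<in> Z_space \<Longrightarrow> u (\<lambda>x. \<phi> x + \<eta> x) = u \<phi> + u \<eta>"
  unfolding Z_antilinear_def by (drule bspec[of _ _ \<phi>], simp, drule bspec[of _ _ \<eta>], simp,
    drule spec[of _ 1], drule spec[of _ "1"]) simp

lemma Z_antilinear_scale:
  "Z_antilinear u \<Longrightarrow> \<phi> \<in> Z_space \<Longrightarrow> u (\<lambda>x. c * \<phi> x) = cnj c * u \<phi>"
  unfolding Z_antilinear_def by (drule bspec[of _ _ \<phi>], simp, drule bspec[of _ _ \<phi>], simp,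
    drule spec[of _ c], drule spec[of _ "0"]) simp

lemma Z_ball_space: "\<phi> \<in> Z_ball N \<Longrightarrow> \<phi> \<in> Z_space"
  by (simp add: Z_ball_def)

lemma Z_ball_antimono:
  assumes "M \<le> N"
  shows "Z_ball N \<subseteq> Z_ball M"
proof -
  have "(1/2::real) ^ N \<le> (1/2) ^ M"
    using assms by (intro power_decreasing) auto
  show ?thesis
  proof
    fix \<phi> :: "real ^ 'a \<Rightarrow> complex" assume \<phi>: "\<phi> \<in> Z_ball N"
    have "schwartz_seminorm \<alpha> is \<phi> \<le> (1/2) ^ M" if "to_nat (\<alpha>, is) \<le> M" for \<alpha> "is"
    proof -
      have "schwartz_seminorm \<alpha> is \<phi> \<le> (1/2) ^ N"
        using \<phi> assms that by (simp add: Z_ball_def)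
      also note \<open>(1/2) ^ N \<le> (1/2) ^ M\<close>
      finally show ?thesis .
    qed
    with \<phi> show "\<phi> \<in> Z_ball M"
      by (simp add: Z_ball_def)
  qed
qed

text \<open>Homogeneity trades the bound \<open>C\<close> for any \<open>e\<close>. The radius
  \<open>d\<close> is kept apart from the index \<open>N\<close>, since continuity is checked on a
  neighbourhood cut out by finitely many seminorms at one radius.\<close>

lemma Z_bounded_small:
  fixes u :: "(real ^ 'n::finite \<Rightarrow> complex) \<Rightarrow> complex"
  assumes "Z_antilinear u" "Z_bounded u" "e > 0"
  obtains N d where "d > 0" "\<And>\<phi>. \<phi> \<in> Z_space \<Longrightarrow>
     (\<And>\<alpha> is. to_nat (\<alpha>, is) \<le> N \<Longrightarrow> schwartz_seminorm \<alpha> is \<phi> \<le> d) \<Longrightarrow> norm (u \<phi>) \<le> e"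
proof -
  obtain N C where C: "\<And>\<phi>. \<phi> \<in> Z_ball N \<Longrightarrow> norm (u \<phi>) \<le> C"
    using assms unfolding Z_bounded_def by blast
  \<comment> \<open>The absolute value and the summand 1 make \<open>t\<close> positive whatever the
    sign of \<open>C\<close>, while \<open>C / t\<close> stays at most \<open>e\<close>.\<close>
  define t where "t = (\<bar>C\<bar> + 1) / e"
  have "t > 0"
    using \<open>e > 0\<close> by (simp add: t_def)
  show ?thesis
  proof (rule that[of "(1/2) ^ N / t"])
    fix \<phi> :: "real ^ 'n \<Rightarrow> complex" assume \<phi>: "\<phi> \<in> Z_space"
      and small: "\<And>\<alpha> is. to_nat (\<alpha>, is) \<le> N \<Longrightarrow> schwartz_seminorm \<alpha> is \<phi> \<le> (1/2) ^ N / t"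
    have "schwartz_seminorm \<alpha> is (\<lambda>x. of_real t * \<phi> x) \<le> (1/2) ^ N" if "to_nat (\<alpha>, is) \<le> N" for \<alpha> "is"
    proof -
      have "schwartz_seminorm \<alpha> is (\<lambda>x. of_real t * \<phi> x) \<le> t * schwartz_seminorm \<alpha> is \<phi>"
        using schwartz_seminorm_lincomb[of \<phi> \<phi> \<alpha> "is" "of_real t" 0] \<phi> \<open>t > 0\<close>
        by (simp add: Z_space_schwartz)
      also have "\<dots> \<le> t * ((1/2) ^ N / t)"
        using \<open>t > 0\<close> small[OF that] by (intro mult_left_mono) auto
      finally show ?thesis
        using \<open>t > 0\<close> by simp
    qed
    then have "norm (u (\<lambda>x. of_real t * \<phi> x)) \<le> C"
      using \<phi> by (intro C) (auto simp: Z_ball_def Z_space_scale)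
    then have "t * norm (u \<phi>) \<le> C"
      using \<phi> assms(1) \<open>t > 0\<close> by (simp add: Z_antilinear_scale norm_mult)
    then have "(\<bar>C\<bar> + 1) * norm (u \<phi>) \<le> C * e"
      using \<open>e > 0\<close> by (simp add: t_def field_simps)
    also have "\<dots> \<le> (\<bar>C\<bar> + 1) * e"
      using \<open>e > 0\<close> by (intro mult_right_mono) auto
    finally show "norm (u \<phi>) \<le> e"
      by (simp add: add_pos_nonneg mult_le_cancel_left_pos)
  qed (use \<open>t > 0\<close> in simp)
qed

lemma Z_bounded_small_ball:
  fixes u :: "(real ^ 'n::finite \<Rightarrow> complex) \<Rightarrow> complex"
  assumes "Z_antilinear u" "Z_bounded u" "e > 0"
  obtains N where "\<And>\<phi>. \<phi> \<in> Z_ball N \<Longrightarrow> norm (u \<phi>) \<le> e"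
proof -
  obtain N d where d: "d > 0" "\<And>\<phi>. \<phi> \<in> Z_space \<Longrightarrow>
     (\<And>\<alpha> is. to_nat (\<alpha>, is) \<le> N \<Longrightarrow> schwartz_seminorm \<alpha> is \<phi> \<le> d) \<Longrightarrow> norm (u \<phi>) \<le> e"
    using Z_bounded_small[OF assms] by metis
  obtain k where k: "(1/2::real) ^ k < d"
    using real_arch_pow_inv[OF d(1), of "1/2"] by auto
  have "(1/2::real) ^ max k N \<le> (1/2) ^ k"
    by (intro power_decreasing) auto
  with k have pow: "(1/2) ^ max k N \<le> d"
    by linarith
  \<comment> \<open>One index does two jobs: at least \<open>N\<close> to test enough seminorms, at
    least \<open>k\<close> to bring the radius below \<open>d\<close>.\<close>
  have "norm (u \<phi>) \<le> e" if \<phi>: "\<phi> \<in> Z_ball (max k N)" for \<phi>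
  proof (rule d(2)[OF Z_ball_space[OF \<phi>]])
    fix \<alpha> :: "'n \<Rightarrow> nat" and "is" :: "'n list" assume "to_nat (\<alpha>, is) \<le> N"
    with \<phi> have "schwartz_seminorm \<alpha> is \<phi> \<le> (1/2) ^ max k N"
      by (simp add: Z_ball_def)
    then show "schwartz_seminorm \<alpha> is \<phi> \<le> d"
      using pow by (rule order_trans)
  qed
  then show ?thesis
    using that by blast
qed

section \<open>The Schwartz topology in terms of seminorms\<close>

lemma schwartz_seminorm_zero: "schwartz_seminorm \<alpha> is (\<lambda>x. 0) = 0"
proof (rule antisym)
  show "schwartz_seminorm \<alpha> is (\<lambda>x. 0) \<le> 0"
    using schwartz_seminorm_lincomb[OF Z_space_schwartz[OF Z_space_zero] Z_space_schwartz[OF Z_space_zero], of \<alpha> "is" 0 0]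
    by simp
qed (rule schwartz_seminorm_nonneg[OF Z_space_schwartz[OF Z_space_zero]])

lemma topspace_schwartz_topology: "topspace schwartz_topology = schwartz_space"
proof -
  have "f \<in> \<Union> {{g \<in> schwartz_space. schwartz_seminorm \<alpha> is (\<lambda>x. g x - f x) < \<epsilon>} | f \<alpha> is \<epsilon>.
        f \<in> schwartz_space \<and> 0 < \<epsilon>}" if "f \<in> schwartz_space" for f :: "real ^ 'a \<Rightarrow> complex"
  proof (rule UnionI)
    show "f \<in> {g \<in> schwartz_space. schwartz_seminorm (\<lambda>_. 0) [] (\<lambda>x. g x - f x) < 1}"
      using that by (simp add: schwartz_seminorm_zero)
    show "{g \<in> schwartz_space. schwartz_seminorm (\<lambda>_. 0) [] (\<lambda>x. g x - f x) < 1} \<in>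
       {{g \<in> schwartz_space. schwartz_seminorm \<alpha> is (\<lambda>x. g x - f x) < \<epsilon>} | f \<alpha> is \<epsilon>.
        f \<in> schwartz_space \<and> 0 < \<epsilon>}"
      by (intro CollectI exI conjI, rule refl) (use that in auto)
  qed
  then show ?thesis
    unfolding schwartz_topology_def topology_generated_by_topspace by auto
qed

text \<open>Smallness near \<open>0\<close> is carried to any \<phi> by additivity:
  \<open>u \<eta> - u \<phi>\<close> is the value at the difference. Subbasic sets may be centred at
  \<phi>, so a finite intersection of them is the neighbourhood sought.\<close>

lemma Z_bounded_imp_continuous:
  fixes u :: "(real ^ 'n::finite \<Rightarrow> complex) \<Rightarrow> complex"
  assumes "Z_antilinear u" "Z_bounded u"
  shows "continuous_map Z_topology euclidean u"
proof -
  have Zsub: "(Z_space :: (real ^ 'n \<Rightarrow> complex) set) \<subseteq> topspace schwartz_topology"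
    unfolding topspace_schwartz_topology using Z_space_schwartz by blast
  have top: "topspace (Z_topology :: (real ^ 'n \<Rightarrow> complex) topology) = Z_space"
    unfolding Z_topology_def using Zsub by (simp add: Int_absorb1)
  have "openin Z_topology {\<phi> \<in> Z_space. u \<phi> \<in> V}" if "open V" for V
  proof (subst openin_subopen, intro ballI)
    fix \<phi> assume "\<phi> \<in> {\<phi> \<in> Z_space. u \<phi> \<in> V}"
    then have \<phi>: "\<phi> \<in> Z_space" "u \<phi> \<in> V"
      by auto
    then obtain e where e: "e > 0" "cball (u \<phi>) e \<subseteq> V"
      using \<open>open V\<close> open_contains_cball by blast
    obtain N d where d: "d > 0" "\<And>\<phi>. \<phi> \<in> Z_space \<Longrightarrow>
       (\<And>\<alpha> is. to_nat (\<alpha>, is) \<le> N \<Longrightarrow> schwartz_seminorm \<alpha> is \<phi> \<le> d) \<Longrightarrow> norm (u \<phi>) \<le> e"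
      using Z_bounded_small[OF assms \<open>e > 0\<close>] by metis
    define B where "B p = {g \<in> schwartz_space. schwartz_seminorm (fst p) (snd p) (\<lambda>x. g x - \<phi> x) < d}"
      for p :: "('n \<Rightarrow> nat) \<times> 'n list"
    \<comment> \<open>Finite because \<open>to_nat\<close> is injective. It may be empty, and then
      the intersection over it is everything; hence the added \<open>topspace\<close>.\<close>
    define I where "I = (to_nat :: ('n \<Rightarrow> nat) \<times> 'n list \<Rightarrow> nat) -` {..N}"
    have "finite I"
      unfolding I_def by (intro finite_vimageI) auto
    have "openin schwartz_topology (B p)" for p
      unfolding schwartz_topology_def B_def
      by (intro topology_generated_by_Basis CollectI exI conjI, rule refl)
        (use \<phi> \<open>d > 0\<close> in \<open>auto intro: Z_space_schwartz\<close>)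
    then have "openin schwartz_topology ((\<Inter>p\<in>I. B p) \<inter> topspace schwartz_topology)"
      by (intro openin_INT \<open>finite I\<close>)
    then have "openin Z_topology (((\<Inter>p\<in>I. B p) \<inter> topspace schwartz_topology) \<inter> Z_space)"
      unfolding Z_topology_def by (rule openin_subtopology_Int)
    moreover have "\<phi> \<in> ((\<Inter>p\<in>I. B p) \<inter> topspace schwartz_topology) \<inter> Z_space"
      using \<phi> \<open>d > 0\<close> by (auto simp: B_def schwartz_seminorm_zero topspace_schwartz_topology Z_space_schwartz)
    moreover have "u \<eta> \<in> V" if \<eta>: "\<eta> \<in> ((\<Inter>p\<in>I. B p) \<inter> topspace schwartz_topology) \<inter> Z_space" for \<eta>
    proof -
      have "\<eta> \<in> Z_space"
        using \<eta> by simp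
      have "schwartz_seminorm \<alpha> is (\<lambda>x. \<eta> x - \<phi> x) \<le> d" if "to_nat (\<alpha>, is) \<le> N" for \<alpha> "is"
      proof -
        have "(\<alpha>, is) \<in> I"
          using that by (simp add: I_def)
        with \<eta> have "\<eta> \<in> B (\<alpha>, is)" by blast
        then show ?thesis
          by (simp add: B_def)
      qed
      then have "norm (u (\<lambda>x. \<eta> x - \<phi> x)) \<le> e"
        by (intro d(2) Z_space_diff \<open>\<eta> \<in> Z_space\<close> \<phi>(1))
      then have "u \<eta> \<in> cball (u \<phi>) e"
        using assms(1) \<phi>(1) \<open>\<eta> \<in> Z_space\<close> by (simp add: Z_antilinear_diff dist_norm norm_minus_commute)
      then show ?thesis
        using e by blast
    qed
    ultimately show "\<exists>T. openin Z_topology T \<and> \<phi> \<in> T \<and> T \<subseteq> {\<phi> \<in> Z_space. u \<phi> \<in> V}"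
      by (intro exI[of _ "((\<Inter>p\<in>I. B p) \<inter> topspace schwartz_topology) \<inter> Z_space"]) blast
  qed
  then show ?thesis
    by (simp add: continuous_map_def top)
qed

section \<open>Nested balls and the uniform boundedness principle\<close>

lemma schwartz_seminorm_diff_commute:
  assumes "f \<in> schwartz_space" "g \<in> schwartz_space"
  shows "schwartz_seminorm \<alpha> is (\<lambda>x. f x - g x) = schwartz_seminorm \<alpha> is (\<lambda>x. g x - f x)"
  unfolding schwartz_seminorm_def using assms
  by (simp add: iterated_derivative_diff norm_mult norm_minus_commute)

text \<open>A step inside the ball of index \<open>Suc (N k)\<close> spends at most half of the
  radius \<open>(1/2) ^ N k\<close>; as \<open>N\<close> increases strictly, all later steps
  together fit into the other half. Every seminorm is tested from some stage on, so the sequence is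
  Cauchy in each of them.\<close>

lemma Z_ball_telescope:
  fixes f :: "nat \<Rightarrow> real ^ 'n::finite \<Rightarrow> complex" and N :: "nat \<Rightarrow> nat"
  assumes f: "\<And>k. f k \<in> Z_space" and N: "strict_mono N"
    and step: "\<And>k. (\<lambda>x. f (Suc k) x - f k x) \<in> Z_ball (Suc (N k))"
  obtains g where "g \<in> Z_space" "\<And>k. (\<lambda>x. g x - f k x) \<in> Z_ball (N k)"
proof -
  \<comment> \<open>The subtracted \<open>(1/2) ^ N m\<close> is the budget still unspent; it is
    what lets the induction close.\<close>
  have tail: "schwartz_seminorm \<alpha> is (\<lambda>x. f m x - f k x) \<le> (1/2) ^ N k - (1/2) ^ N m"
    if p: "to_nat (\<alpha>, is) \<le> N k" and "k \<le> m" for \<alpha> "is" k m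
    using \<open>k \<le> m\<close>
  proof (induction m rule: dec_induct)
    case base
    show ?case by (simp add: schwartz_seminorm_zero)
  next
    case (step m)
    have "N k \<le> N m"
      using N \<open>k \<le> m\<close> by (simp add: strict_mono_less_eq)
    then have "schwartz_seminorm \<alpha> is (\<lambda>x. f (Suc m) x - f m x) \<le> (1/2) ^ Suc (N m)"
      using assms(3)[of m] p by (simp add: Z_ball_def)
    moreover have "(1/2::real) ^ N (Suc m) \<le> (1/2) ^ Suc (N m)"
      using N by (intro power_decreasing) (auto simp: strict_mono_Suc_iff Suc_le_eq)
    moreover have "(1/2::real) ^ Suc (N m) + (1/2) ^ Suc (N m) = (1/2) ^ N m"
      by simp
    ultimately show ?case
      using step.IH schwartz_seminorm_diff_triangle[of "f (Suc m)" "f m" "f k" \<alpha> "is"]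
        Z_space_schwartz[OF f] by fastforce
  qed
  have tail': "schwartz_seminorm \<alpha> is (\<lambda>x. f m x - f k x) \<le> (1/2) ^ N k"
    if "to_nat (\<alpha>, is) \<le> N k" "k \<le> m" for \<alpha> "is" k m
    using tail[OF that] by (rule order_trans) simp
  have Cauchy: "\<exists>M. \<forall>m\<ge>M. \<forall>n\<ge>M. schwartz_seminorm \<alpha> is (\<lambda>x. f m x - f n x) < e" if "e > 0" for \<alpha> "is" e
  proof -
    obtain k where k: "(1/2::real) ^ k < e / 2"
      using real_arch_pow_inv[of "e/2" "1/2"] \<open>e > 0\<close> by auto
    \<comment> \<open>At stage \<open>M\<close> the given seminorm is tested and the radius is below
      \<open>e / 2\<close>, since \<open>M \<le> N M\<close> for strictly increasing
      \<open>N\<close>.\<close>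
    define M where "M = max k (to_nat (\<alpha>, is))"
    have "M \<le> N M"
      using N by (rule strict_mono_imp_increasing)
    then have M: "to_nat (\<alpha>, is) \<le> N M" "k \<le> N M"
      by (auto simp: M_def)
    have pow: "(1/2::real) ^ N M \<le> (1/2) ^ k"
      using M by (intro power_decreasing) auto
    have small: "schwartz_seminorm \<alpha> is (\<lambda>x. f m x - f n x) \<le> (1/2) ^ N M + (1/2) ^ N M"
      if "m \<ge> M" "n \<ge> M" for m n
    proof -
      have "schwartz_seminorm \<alpha> is (\<lambda>x. f m x - f n x) \<le>
        schwartz_seminorm \<alpha> is (\<lambda>x. f m x - f M x) + schwartz_seminorm \<alpha> is (\<lambda>x. f n x - f M x)"
        using schwartz_seminorm_diff_triangle[of "f m" "f M" "f n" \<alpha> "is"] Z_space_schwartz[OF f]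
        by (simp add: schwartz_seminorm_diff_commute[of "f n" "f M"])
      then show ?thesis
        using tail'[OF M(1) that(1)] tail'[OF M(1) that(2)] by linarith
    qed
    have "schwartz_seminorm \<alpha> is (\<lambda>x. f m x - f n x) < e" if "m \<ge> M" "n \<ge> M" for m n
      using small[OF that] pow k by linarith
    then show ?thesis
      by blast
  qed
  obtain g where g: "g \<in> Z_space"
    "\<And>\<alpha> is m e. (\<And>n. n \<ge> m \<Longrightarrow> schwartz_seminorm \<alpha> is (\<lambda>x. f n x - f m x) \<le> e) \<Longrightarrow>
      schwartz_seminorm \<alpha> is (\<lambda>x. g x - f m x) \<le> e"
    using Z_space_complete[OF f Cauchy] by blast
  show ?thesis
  proof (rule that[OF g(1)])
    show "(\<lambda>x. g x - f k x) \<in> Z_ball (N k)" for k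
      using tail' by (auto simp: Z_ball_def intro!: Z_space_diff g f)
  qed
qed

text \<open>The gliding hump in nested form: each step moves by less than the current ball and makes some
  \<open>F i\<close> exceed \<open>n\<close> on a whole smaller ball, so the limit contradicts pointwise boundedness.\<close>

lemma Z_uniform_boundedness:
  fixes F :: "'i \<Rightarrow> (real ^ 'n::finite \<Rightarrow> complex) \<Rightarrow> complex"
  assumes lin: "\<And>i. Z_antilinear (F i)" and bdd: "\<And>i. Z_bounded (F i)"
    and pt: "\<And>\<phi>. \<phi> \<in> Z_space \<Longrightarrow> \<exists>C. \<forall>i. norm (F i \<phi>) \<le> C"
  shows "\<exists>N C. \<forall>\<phi>\<in>Z_ball N. \<forall>i. norm (F i \<phi>) \<le> C"
proof (rule ccontr)
  assume "\<not> ?thesis"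
  then have large: "\<exists>\<phi>\<in>Z_ball N. \<exists>i. norm (F i \<phi>) > C" for N C
    by (meson not_le)
  \<comment> \<open>A state is a centre with a ball index; \<open>P n s\<close> says that one
    \<open>F i\<close> has norm at least \<open>n\<close> on the entire ball.\<close>
  define P where "P n s \<longleftrightarrow> fst s \<in> Z_space \<and>
      (\<exists>i. \<forall>y\<in>Z_space. (\<lambda>x. y x - fst s x) \<in> Z_ball (snd s) \<longrightarrow> norm (F i y) \<ge> real n)"
    for n and s :: "(real ^ 'n \<Rightarrow> complex) \<times> nat"
  \<comment> \<open>\<open>Suc\<close> leaves half of the radius for later steps; the strict
    increase of the index is what \<open>Z_ball_telescope\<close> consumes.\<close>
  define R where "R s t \<longleftrightarrow> (\<lambda>x. fst t x - fst s x) \<in> Z_ball (Suc (snd s)) \<and> snd s < snd t"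
    for s t :: "(real ^ 'n \<Rightarrow> complex) \<times> nat"
  have "\<exists>s. \<forall>n. P n (s n) \<and> R (s n) (s (Suc n))"
  proof (rule dependent_nat_choice)
    show "\<exists>s. P 0 s"
      by (auto simp: P_def intro!: exI[of _ "\<lambda>x. 0"] Z_space_zero)
  next
    fix s n assume "P n s"
    then have s: "fst s \<in> Z_space"
      by (simp add: P_def)
    obtain C where C: "\<And>i. norm (F i (fst s)) \<le> C"
      using pt[OF s] by blast
    \<comment> \<open>The summand \<open>C\<close> absorbs the value of \<open>F i\<close> at the
      old centre; of the remaining \<open>n + 2\<close>, one unit is given up to variation over the
      new ball, which leaves \<open>Suc n\<close>.\<close>
    obtain \<phi> i where \<phi>: "\<phi> \<in> Z_ball (Suc (snd s))" "norm (F i \<phi>) > C + real n + 2"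
      using large by blast
    define x' where "x' = (\<lambda>x. fst s x + \<phi> x)"
    have x': "x' \<in> Z_space"
      using Z_space_lincomb[OF s Z_ball_space[OF \<phi>(1)], of 1 1] by (simp add: x'_def)
    have "F i x' = F i (fst s) + F i \<phi>"
      unfolding x'_def by (intro Z_antilinear_add lin s Z_ball_space[OF \<phi>(1)])
    then have Fx': "norm (F i x') > real n + 2"
      using \<phi>(2) C[of i] norm_diff_ineq[of "F i \<phi>" "F i (fst s)"] by (simp add: add.commute)
    obtain N where N: "\<And>\<phi>. \<phi> \<in> Z_ball N \<Longrightarrow> norm (F i \<phi>) \<le> 1"
      using Z_bounded_small_ball[OF lin bdd zero_less_one] by metis
    \<comment> \<open>The index \<open>N\<close> depends on the \<open>i\<close> just found, so the
      ball is chosen last; the maximum keeps the indices strictly increasing.\<close>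
    define N' where "N' = max N (Suc (snd s))"
    have "norm (F i y) \<ge> real (Suc n)"
      if y: "y \<in> Z_space" and "(\<lambda>x. y x - x' x) \<in> Z_ball N'" for y
    proof -
      have "(\<lambda>x. y x - x' x) \<in> Z_ball N"
        using that Z_ball_antimono[of N N'] by (auto simp: N'_def)
      then have "norm (F i y - F i x') \<le> 1"
        using N Z_antilinear_diff[OF lin y x', of i] by metis
      then show ?thesis
        using Fx' norm_triangle_ineq2[of "F i x'" "F i y"] by (simp add: norm_minus_commute)
    qed
    then have "P (Suc n) (x', N')"
      using x' by (auto simp: P_def)
    moreover have "R s (x', N')"
      using \<phi> by (simp add: R_def x'_def N'_def)
    ultimately show "\<exists>t. P (Suc n) t \<and> R s t"
      by blast
  qed
  then obtain s where s: "\<And>n. P n (s n)" "\<And>n. R (s n) (s (Suc n))"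
    by blast
  obtain g where g: "g \<in> Z_space" "\<And>k. (\<lambda>x. g x - fst (s k) x) \<in> Z_ball (snd (s k))"
  proof (rule Z_ball_telescope[of "\<lambda>k. fst (s k)" "\<lambda>k. snd (s k)"])
    show "strict_mono (\<lambda>k. snd (s k))"
      using s(2) by (simp add: strict_mono_Suc_iff R_def)
  qed (use s in \<open>auto simp: P_def R_def\<close>)
  \<comment> \<open>The limit \<open>g\<close> lies in every ball, so stage \<open>k\<close> forces
    a value of norm at least \<open>k\<close> at \<open>g\<close>.\<close>
  then have unb: "\<exists>i. norm (F i g) \<ge> real k" for k
    using s(1)[of k] unfolding P_def by blast
  obtain C where C: "\<And>i. norm (F i g) \<le> C"
    using pt[OF g(1)] by blast
  obtain k :: nat where "real k > C"
    using reals_Archimedean2 by blast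
  with unb[of k] C show False
    by (meson le_less_trans not_le order_trans)
qed

section \<open>The synthesis operator\<close>

lemma pairing_bounded_continuous:
  fixes f :: "real ^ 'n::finite \<Rightarrow> complex"
  assumes f: "continuous_on UNIV f" "bounded (range f)" and \<phi>: "\<phi> \<in> schwartz_space"
  shows "integrable lborel (\<lambda>x. f x * cnj (\<phi> x))"
proof -
  obtain B where B: "\<And>x. norm (f x) \<le> B"
    using f(2) unfolding bounded_iff by auto
  have int: "integrable lborel \<phi>"
    using schwartz_moment_integrable(1)[OF \<phi>, of "\<lambda>_. 0"] by (simp add: monomial_def)
  have "continuous_on UNIV \<phi>"
    using smooth_imp_continuous_on[OF schwartz_space_smooth[OF \<phi>], of UNIV "[]"] by simp
  then have "(\<lambda>x. f x * cnj (\<phi> x)) \<in> borel_measurable lborel"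
    using f(1) by (auto intro!: borel_measurable_continuous_onI continuous_intros)
  moreover have "norm (f x * cnj (\<phi> x)) \<le> norm (of_real B * \<phi> x)" for x
    using B[of x] by (simp add: norm_mult mult_right_mono)
  ultimately show ?thesis
    by (intro Bochner_Integration.integrable_bound[OF integrable_mult_right[OF int, of "of_real B"]] AE_I2)
qed

lemma Z_antilinear_pairing:
  fixes f :: "real ^ 'n::finite \<Rightarrow> complex"
  assumes "continuous_on UNIV f" "bounded (range f)"
  shows "Z_antilinear (pairing f)"
  unfolding Z_antilinear_def
proof (intro ballI allI)
  fix \<phi> \<eta> :: "real ^ 'n \<Rightarrow> complex" and c d assume "\<phi> \<in> Z_space" "\<eta> \<in> Z_space"
  note int = pairing_bounded_continuous[OF assms Z_space_schwartz, THEN integrable_mult_right]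
  have "pairing f (\<lambda>x. c * \<phi> x + d * \<eta> x) =
     (LINT x|lborel. cnj c * (f x * cnj (\<phi> x)) + cnj d * (f x * cnj (\<eta> x)))"
    unfolding pairing_def by (simp add: algebra_simps)
  also have "\<dots> = cnj c * pairing f \<phi> + cnj d * pairing f \<eta>"
    unfolding pairing_def
    by (subst Bochner_Integration.integral_add[OF int[OF \<open>\<phi> \<in> Z_space\<close>] int[OF \<open>\<eta> \<in> Z_space\<close>]]) simp
  finally show "pairing f (\<lambda>x. c * \<phi> x + d * \<eta> x) = cnj c * pairing f \<phi> + cnj d * pairing f \<eta>" .
qed

text \<open>The pairing is at most \<open>B\<close> times the L1 norm of \<phi>, which is bounded by
  finitely many seminorms without derivatives, with exponent 0 or 2 in each coordinate.\<close>

lemma Z_bounded_pairing: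
  fixes f :: "real ^ 'n::finite \<Rightarrow> complex"
  assumes "continuous_on UNIV f" "bounded (range f)"
  shows "Z_bounded (pairing f)"
proof -
  obtain B where B: "\<And>x. norm (f x) \<le> B"
    using assms(2) unfolding bounded_iff by auto
  then have "B \<ge> 0"
    by (meson norm_ge_zero order_trans)
  define \<beta> where "\<beta> X = (\<lambda>i::'n. if i \<in> X then 2 else 0 :: nat)" for X
  \<comment> \<open>Large enough for \<open>Z_ball N\<close> to test all the exponents
    \<open>\<beta> X\<close>; each seminorm is then at most \<open>(1/2) ^ N\<close>, hence at most
    1.\<close>
  define N where "N = Max (range (\<lambda>X. to_nat (\<beta> X, [] :: 'n list)))"
  define I where "I = (LINT x|(lborel :: (real ^ 'n) measure). inverse (decay_weight x))"
  have "I \<ge> 0"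
    unfolding I_def by (intro integral_nonneg_AE AE_I2) (simp add: decay_weight_pos less_imp_le)
  have "norm (pairing f \<phi>) \<le> B * ((\<Sum>X\<in>(UNIV :: 'n set set). 1) * I)" if \<phi>: "\<phi> \<in> Z_ball N" for \<phi>
  proof -
    have \<phi>S: "\<phi> \<in> schwartz_space"
      using Z_space_schwartz[OF Z_ball_space[OF \<phi>]] .
    have int: "integrable lborel \<phi>"
      using schwartz_moment_integrable(1)[OF \<phi>S, of "\<lambda>_. 0"] by (simp add: monomial_def)
    have "norm (pairing f \<phi>) \<le> (LINT x|lborel. norm (f x * cnj (\<phi> x)))"
      unfolding pairing_def by (rule integral_norm_bound)
    also have "\<dots> \<le> (LINT x|lborel. B * norm (\<phi> x))"
      using int B by (intro integral_mono integrable_norm pairing_bounded_continuous assms \<phi>S)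
        (auto simp: norm_mult intro!: mult_right_mono)
    also have "\<dots> = B * (LINT x|lborel. norm (\<phi> x))"
      by simp
    also have "(LINT x|lborel. norm (\<phi> x)) \<le> (\<Sum>X\<in>UNIV. schwartz_seminorm (\<beta> X) [] \<phi>) * I"
      using schwartz_moment_integrable(2)[OF \<phi>S, of "\<lambda>_. 0"]
      by (simp add: monomial_def I_def \<beta>_def)
    also have "(\<Sum>X\<in>UNIV. schwartz_seminorm (\<beta> X) [] \<phi>) \<le> (\<Sum>X\<in>(UNIV :: 'n set set). 1)"
    proof (rule sum_mono)
      fix X
      have "to_nat (\<beta> X, [] :: 'n list) \<le> N"
        unfolding N_def by (intro Max_ge) auto
      then have "schwartz_seminorm (\<beta> X) [] \<phi> \<le> (1/2) ^ N"
        using \<phi> by (simp add: Z_ball_def)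
      also have "\<dots> \<le> 1"
        by (simp add: power_le_one)
      finally show "schwartz_seminorm (\<beta> X) [] \<phi> \<le> 1" .
    qed
    finally show ?thesis
      using \<open>B \<ge> 0\<close> \<open>I \<ge> 0\<close> by (simp add: mult_left_mono mult_right_mono)
  qed
  then show ?thesis
    unfolding Z_bounded_def by blast
qed

lemma Z_antilinear_sum:
  fixes u :: "'i \<Rightarrow> (real ^ 'n::finite \<Rightarrow> complex) \<Rightarrow> complex"
  assumes "\<And>i. i \<in> A \<Longrightarrow> Z_antilinear (u i)"
  shows "Z_antilinear (\<lambda>\<phi>. \<Sum>i\<in>A. c i * u i \<phi>)"
  unfolding Z_antilinear_def
proof (intro ballI allI)
  fix \<phi> \<eta> :: "real ^ 'n \<Rightarrow> complex" and d e assume "\<phi> \<in> Z_space" "\<eta> \<in> Z_space"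
  then have "(\<Sum>i\<in>A. c i * u i (\<lambda>x. d * \<phi> x + e * \<eta> x)) =
      (\<Sum>i\<in>A. cnj d * (c i * u i \<phi>) + cnj e * (c i * u i \<eta>))"
    using assms unfolding Z_antilinear_def by (intro sum.cong) (simp_all add: algebra_simps)
  then show "(\<Sum>i\<in>A. c i * u i (\<lambda>x. d * \<phi> x + e * \<eta> x)) =
      cnj d * (\<Sum>i\<in>A. c i * u i \<phi>) + cnj e * (\<Sum>i\<in>A. c i * u i \<eta>)"
    by (simp add: sum.distrib sum_distrib_left)
qed

lemma Z_bounded_sum:
  assumes "finite A" "\<And>i. i \<in> A \<Longrightarrow> Z_bounded (u i)"
  shows "Z_bounded (\<lambda>\<phi>. \<Sum>i\<in>A. c i * u i \<phi>)"
  using assms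
proof (induction A rule: finite_induct)
  case empty
  show ?case by (auto simp: Z_bounded_def)
next
  case (insert j A)
  then obtain M N C D where
    C: "\<And>\<phi>. \<phi> \<in> Z_ball M \<Longrightarrow> norm (u j \<phi>) \<le> C" and
    D: "\<And>\<phi>. \<phi> \<in> Z_ball N \<Longrightarrow> norm (\<Sum>i\<in>A. c i * u i \<phi>) \<le> D"
    unfolding Z_bounded_def by (metis insert_iff)
  have "norm (\<Sum>i\<in>insert j A. c i * u i \<phi>) \<le> norm (c j) * C + D" if "\<phi> \<in> Z_ball (max M N)" for \<phi>
  proof -
    have "\<phi> \<in> Z_ball M" "\<phi> \<in> Z_ball N"
      using that Z_ball_antimono[of M "max M N"] Z_ball_antimono[of N "max M N"] by auto
    then have "norm (c j * u j \<phi>) + norm (\<Sum>i\<in>A. c i * u i \<phi>) \<le> norm (c j) * C + D"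
      by (intro add_mono) (auto simp: norm_mult intro: mult_left_mono C D)
    then show ?thesis
      using insert.hyps norm_triangle_le by auto
  qed
  then show ?case
    unfolding Z_bounded_def by blast
qed

section \<open>Dyadic dilates, the sequence space and truncations\<close>

lemma continuous_on_dyadic_dilate:
  assumes "continuous_on UNIV \<psi>"
  shows "continuous_on UNIV (dyadic_dilate \<psi> Q)"
proof (cases Q)
  case (Pair \<nu> k)
  show ?thesis
    unfolding Pair dyadic_dilate_def prod.case
    by (intro continuous_intros continuous_on_compose2[OF assms]) auto
qed

lemma bounded_dyadic_dilate:
  assumes "bounded (range \<psi>)"
  shows "bounded (range (dyadic_dilate \<psi> Q))"
proof (cases Q)
  case (Pair \<nu> k)
  obtain B where "\<And>x. norm (\<psi> x) \<le> B"
    using assms unfolding bounded_iff by auto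
  then have "norm (dyadic_dilate \<psi> Q x) \<le> norm (of_real (2 powr (real CARD('a) * of_int \<nu> / 2)) :: complex) * B" for x
    unfolding Pair dyadic_dilate_def prod.case norm_mult by (intro mult_left_mono) auto
  then show ?thesis
    unfolding bounded_iff by blast
qed

lemma pairing_sum:
  assumes "\<And>i. i \<in> A \<Longrightarrow> continuous_on UNIV (f i)" "\<And>i. i \<in> A \<Longrightarrow> bounded (range (f i))"
    and "\<phi> \<in> schwartz_space"
  shows "pairing (\<lambda>x. \<Sum>i\<in>A. c i * f i x) \<phi> = (\<Sum>i\<in>A. c i * pairing (f i) \<phi>)"
proof -
  have int: "integrable lborel (\<lambda>x. c i * (f i x * cnj (\<phi> x)))" if "i \<in> A" for i
    using that by (intro integrable_mult_right pairing_bounded_continuous assms)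
  have "pairing (\<lambda>x. \<Sum>i\<in>A. c i * f i x) \<phi> = (LINT x|lborel. (\<Sum>i\<in>A. c i * (f i x * cnj (\<phi> x))))"
    unfolding pairing_def by (simp add: sum_distrib_right mult.assoc)
  also have "\<dots> = (\<Sum>i\<in>A. c i * pairing (f i) \<phi>)"
    using int by (simp add: pairing_def)
  finally show ?thesis .
qed

text \<open>Every function is measurable for the counting measure, so finiteness of the integral in
  the definition is exactly Bochner integrability.\<close>

lemma L1_sequences_iff:
  "a \<in> L1_sequences \<psi> \<phi> \<longleftrightarrow>
    integrable (count_space UNIV) (\<lambda>Q. a Q * pairing (dyadic_dilate \<psi> Q) \<phi>)"
  by (simp add: L1_sequences_def integrable_iff_bounded norm_mult)

lemma synthesis_domain_iff:
  "a \<in> synthesis_domain \<psi> \<longleftrightarrow> (\<forall>\<phi>\<in>Z_space.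
    integrable (count_space UNIV) (\<lambda>Q. a Q * pairing (dyadic_dilate \<psi> Q) \<phi>))"
  by (simp add: synthesis_domain_def L1_sequences_iff)

lemma integrable_count_space_finite_support:
  fixes h :: "'a \<Rightarrow> complex"
  assumes "finite {x. h x \<noteq> 0}"
  shows "integrable (count_space UNIV) h"
proof -
  have "(\<integral>\<^sup>+x. ennreal (norm (h x)) \<partial>count_space UNIV) = (\<Sum>x | h x \<noteq> 0. ennreal (norm (h x)))"
    using assms by (subst nn_integral_count_space) auto
  also have "\<dots> < \<infinity>"
    by auto
  finally show ?thesis
    by (simp add: integrable_iff_bounded)
qed

text \<open>The integrands are dominated by \<open>norm (h x)\<close> and eventually constant at
  each point, because the sets increase and reach every point where \<open>h\<close> is
  nonzero.\<close>

lemma tendsto_integral_truncation: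
  fixes h :: "'a \<Rightarrow> complex"
  assumes h: "integrable (count_space UNIV) h"
    and S: "incseq S" "{x. h x \<noteq> 0} \<subseteq> (\<Union>m. S m)"
  shows "(\<lambda>m::nat. LINT x|count_space UNIV. indicator (S m) x * h x) \<longlonglongrightarrow> (LINT x|count_space UNIV. h x)"
proof (rule integral_dominated_convergence[where w = "\<lambda>x. norm (h x)"])
  show "AE x in count_space UNIV. (\<lambda>m. indicator (S m) x * h x) \<longlonglongrightarrow> h x"
  proof (intro AE_I2)
    fix x
    show "(\<lambda>m. indicator (S m) x * h x) \<longlonglongrightarrow> h x"
    proof (cases "h x = 0")
      case False
      then obtain M where "x \<in> S M"
        using S(2) by blast
      then have "x \<in> S m" if "m \<ge> M" for m
        using S(1) that by (auto simp: incseq_def)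
      then have "\<forall>m\<ge>M. indicator (S m) x * h x = h x"
        by simp
      then show ?thesis
        by (intro tendsto_eventually) (auto simp: eventually_sequentially)
    qed simp
  qed
qed (use h in \<open>auto simp: indicator_def norm_mult\<close>)

text \<open>Restriction to \<open>Z_space\<close> makes the functional extensional, as
  \<open>Z_dual\<close> requires. A non-integrable integrand would give the default value 0; on
  \<open>synthesis_domain\<close> this does not occur.\<close>

definition synthesis ::
    "(real ^ 'n::finite \<Rightarrow> complex) \<Rightarrow> ('n dyadic \<Rightarrow> complex) \<Rightarrow> (real ^ 'n \<Rightarrow> complex) \<Rightarrow> complex" where
  "synthesis \<psi> a = (\<lambda>\<phi>\<in>Z_space. LINT Q|count_space UNIV. a Q * pairing (dyadic_dilate \<psi> Q) \<phi>)"

lemma synthesis_apply: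
  "\<phi> \<in> Z_space \<Longrightarrow>
    synthesis \<psi> a \<phi> = (LINT Q|count_space UNIV. a Q * pairing (dyadic_dilate \<psi> Q) \<phi>)"
  by (simp add: synthesis_def)

lemma synthesis_finite_support:
  assumes "finite {Q. a Q \<noteq> 0}" "\<phi> \<in> Z_space"
  shows "synthesis \<psi> a \<phi> = (\<Sum>Q | a Q \<noteq> 0. a Q * pairing (dyadic_dilate \<psi> Q) \<phi>)"
proof -
  have fin: "finite {Q. a Q * pairing (dyadic_dilate \<psi> Q) \<phi> \<noteq> 0}"
    by (rule finite_subset[OF _ assms(1)]) auto
  have "synthesis \<psi> a \<phi> = (\<Sum>Q | a Q * pairing (dyadic_dilate \<psi> Q) \<phi> \<noteq> 0. a Q * pairing (dyadic_dilate \<psi> Q) \<phi>)"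
    using assms(2) lebesgue_integral_count_space_finite_support[of UNIV "\<lambda>Q. a Q * pairing (dyadic_dilate \<psi> Q) \<phi>"] fin
    by (simp add: synthesis_apply)
  \<comment> \<open>The pairing may vanish at cubes where \<open>a\<close> does not, so the sum on
    the right can have more terms; the added ones are 0.\<close>
  also have "\<dots> = (\<Sum>Q | a Q \<noteq> 0. a Q * pairing (dyadic_dilate \<psi> Q) \<phi>)"
    using assms(1) by (intro sum.mono_neutral_left) auto
  finally show ?thesis .
qed

lemma synthesis_domain_finite_support:
  assumes "finite {Q. a Q \<noteq> 0}"
  shows "a \<in> synthesis_domain \<psi>"
  unfolding synthesis_domain_iff
proof
  fix \<phi> :: "real ^ 'a \<Rightarrow> complex"
  show "integrable (count_space UNIV) (\<lambda>Q. a Q * pairing (dyadic_dilate \<psi> Q) \<phi>)"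
    by (rule integrable_count_space_finite_support, rule finite_subset[OF _ assms]) auto
qed

lemma finite_support_truncation: "finite S \<Longrightarrow> finite {Q. indicator S Q * (a Q :: complex) \<noteq> 0}"
  by (erule rev_finite_subset) (auto simp: indicator_def split: if_splits)

lemma synthesis_truncation_limit:
  assumes a: "a \<in> synthesis_domain \<psi>" and \<phi>: "\<phi> \<in> Z_space"
    and S: "incseq S" "{Q. a Q \<noteq> 0} \<subseteq> (\<Union>m. S m)"
  shows "(\<lambda>m. synthesis \<psi> (\<lambda>Q. indicator (S m) Q * a Q) \<phi>) \<longlonglongrightarrow> synthesis \<psi> a \<phi>"
proof -
  have "integrable (count_space UNIV) (\<lambda>Q. a Q * pairing (dyadic_dilate \<psi> Q) \<phi>)"
    using a \<phi> by (simp add: synthesis_domain_iff)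
  from tendsto_integral_truncation[OF this S(1)] S(2) show ?thesis
    by (force simp: synthesis_apply[OF \<phi>] mult.assoc)
qed

text \<open>The elements with code at most \<open>m\<close> give a concrete exhaustion by finite
  sets. For cubes it serves both the partial sums and the uniqueness argument.\<close>

lemma incseq_enumeration: "incseq (\<lambda>m. (to_nat :: 'a::countable \<Rightarrow> nat) -` {..m})"
  by (auto simp: incseq_def)

lemma finite_enumeration: "finite ((to_nat :: 'a::countable \<Rightarrow> nat) -` {..m})"
  by (intro finite_vimageI) auto

lemma Union_enumeration: "(\<Union>m. (to_nat :: 'a::countable \<Rightarrow> nat) -` {..m}) = UNIV"
  by auto

lemma synthesis_antilinear:
  fixes \<psi> :: "real ^ 'n::finite \<Rightarrow> complex"
  assumes \<psi>: "continuous_on UNIV \<psi>" "bounded (range \<psi>)" and a: "a \<in> synthesis_domain \<psi>"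
  shows "Z_antilinear (synthesis \<psi> a)"
  unfolding Z_antilinear_def
proof (intro ballI allI)
  fix \<phi> \<eta> :: "real ^ 'n \<Rightarrow> complex" and c d assume Z: "\<phi> \<in> Z_space" "\<eta> \<in> Z_space"
  have int: "integrable (count_space UNIV) (\<lambda>Q. e * (a Q * pairing (dyadic_dilate \<psi> Q) \<zeta>))"
    if "\<zeta> \<in> Z_space" for e \<zeta>
    using a that by (intro integrable_mult_right) (simp add: synthesis_domain_iff)
  have pair: "pairing (dyadic_dilate \<psi> Q) (\<lambda>x. c * \<phi> x + d * \<eta> x) =
      cnj c * pairing (dyadic_dilate \<psi> Q) \<phi> + cnj d * pairing (dyadic_dilate \<psi> Q) \<eta>" for Q
    using Z_antilinear_pairing[OF continuous_on_dyadic_dilate[OF \<psi>(1)] bounded_dyadic_dilate[OF \<psi>(2)], of Q] Z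
    unfolding Z_antilinear_def by blast
  have "synthesis \<psi> a (\<lambda>x. c * \<phi> x + d * \<eta> x) =
     (LINT Q|count_space UNIV. cnj c * (a Q * pairing (dyadic_dilate \<psi> Q) \<phi>) +
       cnj d * (a Q * pairing (dyadic_dilate \<psi> Q) \<eta>))"
    by (simp add: synthesis_apply Z Z_space_lincomb pair algebra_simps)
  also have "\<dots> = cnj c * synthesis \<psi> a \<phi> + cnj d * synthesis \<psi> a \<eta>"
    by (subst Bochner_Integration.integral_add[OF int int]) (simp_all add: synthesis_apply Z)
  finally show "synthesis \<psi> a (\<lambda>x. c * \<phi> x + d * \<eta> x) = cnj c * synthesis \<psi> a \<phi> + cnj d * synthesis \<psi> a \<eta>" .
qed

text \<open>Partial sums are the operator applied to truncations, so they converge, and hence are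
  bounded, at each single \<phi>. The common bound on one ball then passes to the limit.\<close>

lemma synthesis_bounded:
  fixes \<psi> :: "real ^ 'n::finite \<Rightarrow> complex"
  assumes \<psi>: "continuous_on UNIV \<psi>" "bounded (range \<psi>)" and a: "a \<in> synthesis_domain \<psi>"
  shows "Z_bounded (synthesis \<psi> a)"
proof -
  define F where "F m \<phi> = (\<Sum>Q\<in>to_nat -` {..m}. a Q * pairing (dyadic_dilate \<psi> Q) \<phi>)" for m \<phi>
  have F_eq: "F m \<phi> = synthesis \<psi> (\<lambda>Q. indicator (to_nat -` {..m}) Q * a Q) \<phi>" if "\<phi> \<in> Z_space" for m \<phi>
    unfolding F_def synthesis_finite_support[OF finite_support_truncation[OF finite_enumeration] that]
    by (rule sum.mono_neutral_cong_right) (auto simp: finite_enumeration indicator_def split: if_splits)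
  have lim: "(\<lambda>m. F m \<phi>) \<longlonglongrightarrow> synthesis \<psi> a \<phi>" if "\<phi> \<in> Z_space" for \<phi>
    unfolding F_eq[OF that]
    by (rule synthesis_truncation_limit[OF a that incseq_enumeration]) (simp add: Union_enumeration)
  have "\<exists>N C. \<forall>\<phi>\<in>Z_ball N. \<forall>m. norm (F m \<phi>) \<le> C"
  proof (rule Z_uniform_boundedness)
    show "Z_antilinear (F m)" for m
      unfolding F_def
      by (intro Z_antilinear_sum Z_antilinear_pairing continuous_on_dyadic_dilate bounded_dyadic_dilate \<psi>)
    show "Z_bounded (F m)" for m
      unfolding F_def
      by (intro Z_bounded_sum Z_bounded_pairing continuous_on_dyadic_dilate bounded_dyadic_dilate \<psi>
          finite_enumeration)
    show "\<exists>C. \<forall>m. norm (F m \<phi>) \<le> C" if "\<phi> \<in> Z_space" for \<phi>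
      using convergent_imp_Bseq[OF convergentI[OF lim[OF that]]] by (auto simp: Bseq_def)
  qed
  then obtain N C where C: "\<And>\<phi> m. \<phi> \<in> Z_ball N \<Longrightarrow> norm (F m \<phi>) \<le> C"
    by blast
  have "norm (synthesis \<psi> a \<phi>) \<le> C" if "\<phi> \<in> Z_ball N" for \<phi>
    using tendsto_norm[OF lim[OF Z_ball_space[OF that]]] C[OF that]
    by (intro LIMSEQ_le_const2) auto
  then show ?thesis
    unfolding Z_bounded_def by blast
qed

lemma synthesis_in_Z_dual:
  assumes "continuous_on UNIV \<psi>" "bounded (range \<psi>)" "a \<in> synthesis_domain \<psi>"
  shows "synthesis \<psi> a \<in> Z_dual"
  using synthesis_antilinear[OF assms] synthesis_bounded[OF assms]
  by (auto simp: Z_dual_def Z_antilinear_add Z_antilinear_scale Z_bounded_imp_continuous)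
    (simp add: synthesis_def)

text \<open>Convergence in a product is coordinatewise. The product also asks for extensional
  members, which membership in \<open>Z_dual\<close> already includes.\<close>

lemma limitin_Z_dual_weak_star:
  "limitin Z_dual_weak_star u v sequentially \<longleftrightarrow> v \<in> Z_dual \<and>
     (\<forall>\<^sub>F m in sequentially. u m \<in> Z_dual) \<and> (\<forall>\<phi>\<in>Z_space. (\<lambda>m. u m \<phi>) \<longlonglongrightarrow> v \<phi>)"
proof -
  have "v \<in> Z_dual \<Longrightarrow> v \<in> extensional Z_space" for v :: "(real ^ 'a \<Rightarrow> complex) \<Rightarrow> complex"
    by (simp add: Z_dual_def)
  then show ?thesis
    unfolding Z_dual_weak_star_def limitin_subtopology limitin_componentwise
    by (auto simp: PiE_def elim: eventually_mono)
qed

theorem theorem3p2: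
  fixes \<psi> :: "real ^ 'n::finite \<Rightarrow> complex" and K\<^sub>0 K\<^sub>1 L\<^sub>1 L\<^sub>0 :: real
  assumes "admissible_constants K\<^sub>0 K\<^sub>1 L\<^sub>1 L\<^sub>0"
    and "admissible K\<^sub>0 K\<^sub>1 L\<^sub>1 L\<^sub>0 \<psi>"
  shows "\<exists>T. extends_synthesis \<psi> T \<and> synthesis_linear \<psi> T \<and>
    (\<forall>a\<in>synthesis_domain \<psi>. \<forall>\<phi>\<in>Z_space.
       T a \<phi> = (LINT Q|count_space UNIV. a Q * pairing (dyadic_dilate \<psi> Q) \<phi>)) \<and>
    truncation_limits \<psi> T \<and>
    (\<forall>T'. extends_synthesis \<psi> T' \<and> truncation_limits \<psi> T' \<longrightarrow>
       (\<forall>a\<in>synthesis_domain \<psi>. T' a = T a))"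
proof (intro exI[of _ "synthesis \<psi>"] conjI ballI allI impI)
  have S: "\<psi> \<in> schwartz_space"
    using assms(2) by (simp add: admissible_def)
  have \<psi>: "continuous_on UNIV \<psi>" "bounded (range \<psi>)"
    using smooth_imp_continuous_on[OF schwartz_space_smooth[OF S], of UNIV "[]"]
      schwartz_space_bound[OF S, of "\<lambda>_. 0" _ "[]"]
    by (auto simp: bounded_iff monomial_def)
  note dilate = continuous_on_dyadic_dilate[OF \<psi>(1)] bounded_dyadic_dilate[OF \<psi>(2)]
  show ext: "extends_synthesis \<psi> (synthesis \<psi>)"
    unfolding extends_synthesis_def
  proof (intro conjI allI impI)
    show "synthesis \<psi> \<in> synthesis_domain \<psi> \<rightarrow> Z_dual"
      using synthesis_in_Z_dual[OF \<psi>] by blast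
    fix a :: "'n dyadic \<Rightarrow> complex" assume fin: "finite {Q. a Q \<noteq> 0}"
    then show "a \<in> synthesis_domain \<psi>"
      by (rule synthesis_domain_finite_support)
    show "synthesis \<psi> a = Z_class (\<lambda>x. \<Sum>Q | a Q \<noteq> 0. a Q * dyadic_dilate \<psi> Q x)"
    proof (rule extensionalityI[of _ Z_space])
      show "synthesis \<psi> a \<phi> = Z_class (\<lambda>x. \<Sum>Q | a Q \<noteq> 0. a Q * dyadic_dilate \<psi> Q x) \<phi>"
        if "\<phi> \<in> Z_space" for \<phi>
        using that by (simp add: synthesis_finite_support[OF fin that] Z_class_def pairing_sum[OF dilate]
            Z_space_schwartz)
    qed (simp_all add: synthesis_def Z_class_def)
  qed
  show "synthesis_linear \<psi> (synthesis \<psi>)"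
    unfolding synthesis_linear_def
  proof (intro ballI allI)
    fix a b c d assume ab: "a \<in> synthesis_domain \<psi>" "b \<in> synthesis_domain \<psi>"
    have eq: "(\<lambda>Q. (c * a Q + d * b Q) * pairing (dyadic_dilate \<psi> Q) \<phi>) =
        (\<lambda>Q. c * (a Q * pairing (dyadic_dilate \<psi> Q) \<phi>) + d * (b Q * pairing (dyadic_dilate \<psi> Q) \<phi>))" for \<phi>
      by (simp add: algebra_simps)
    have int: "integrable (count_space UNIV) (\<lambda>Q. c * (a Q * pairing (dyadic_dilate \<psi> Q) \<phi>))"
      "integrable (count_space UNIV) (\<lambda>Q. d * (b Q * pairing (dyadic_dilate \<psi> Q) \<phi>))"
      if "\<phi> \<in> Z_space" for \<phi>
      using ab that by (auto simp: synthesis_domain_iff intro!: integrable_mult_right)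
    have "(\<lambda>Q. c * a Q + d * b Q) \<in> synthesis_domain \<psi>"
      unfolding synthesis_domain_iff eq by (intro ballI Bochner_Integration.integrable_add int)
    moreover have "synthesis \<psi> (\<lambda>Q. c * a Q + d * b Q) \<phi> = c * synthesis \<psi> a \<phi> + d * synthesis \<psi> b \<phi>"
      if "\<phi> \<in> Z_space" for \<phi>
      unfolding synthesis_apply[OF that] eq Bochner_Integration.integral_add[OF int[OF that]] by simp
    ultimately show "(\<lambda>Q. c * a Q + d * b Q) \<in> synthesis_domain \<psi> \<and>
        synthesis \<psi> (\<lambda>Q. c * a Q + d * b Q) = (\<lambda>\<phi>\<in>Z_space. c * synthesis \<psi> a \<phi> + d * synthesis \<psi> b \<phi>)"
      by (auto intro!: extensionalityI[of _ Z_space] simp: synthesis_def)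
  qed
  show "synthesis \<psi> a \<phi> = (LINT Q|count_space UNIV. a Q * pairing (dyadic_dilate \<psi> Q) \<phi>)"
    if "\<phi> \<in> Z_space" for a \<phi>
    using that by (rule synthesis_apply)
  show "truncation_limits \<psi> (synthesis \<psi>)"
    unfolding truncation_limits_def
  proof (intro ballI allI impI, elim conjE)
    fix a and S :: "nat \<Rightarrow> 'n dyadic set"
    assume a: "a \<in> synthesis_domain \<psi>" and fin: "\<forall>m. finite (S m)"
      and S: "incseq S" "{Q. a Q \<noteq> 0} \<subseteq> (\<Union>m. S m)"
    have dual: "synthesis \<psi> (\<lambda>Q. indicator (S m) Q * a Q) \<in> Z_dual" for m
      using fin by (intro synthesis_in_Z_dual \<psi> synthesis_domain_finite_support finite_support_truncation) simp
    show "limitin Z_dual_weak_star (\<lambda>m. synthesis \<psi> (\<lambda>Q. indicator (S m) Q * a Q))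
        (synthesis \<psi> a) sequentially"
      unfolding limitin_Z_dual_weak_star
      by (intro conjI ballI always_eventually allI dual synthesis_in_Z_dual[OF \<psi> a]
          synthesis_truncation_limit a S)
  qed
  fix T' a assume T': "extends_synthesis \<psi> T' \<and> truncation_limits \<psi> T'"
    and a: "a \<in> synthesis_domain \<psi>"
  \<comment> \<open>A single exhaustion by finite sets is enough to pin down
    \<open>T' a\<close>.\<close>
  define S where "S m = (to_nat :: 'n dyadic \<Rightarrow> nat) -` {..m}" for m
  have S: "finite (S m)" "incseq S" "(\<Union>m. S m) = UNIV" for m
    unfolding S_def by (rule finite_enumeration incseq_enumeration Union_enumeration)+
  have "limitin Z_dual_weak_star (\<lambda>m. T' (\<lambda>Q. indicator (S m) Q * a Q)) (T' a) sequentially"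
    using T' a S unfolding truncation_limits_def by simp
  moreover have "T' (\<lambda>Q. indicator (S m) Q * a Q) = synthesis \<psi> (\<lambda>Q. indicator (S m) Q * a Q)" for m
  proof -
    have fin: "finite {Q. indicator (S m) Q * a Q \<noteq> 0}"
      by (rule finite_support_truncation[OF S(1)])
    \<comment> \<open>Stated for an arbitrary extension \<open>R\<close> and applied to both
      \<open>T'\<close> and \<open>synthesis \<psi>\<close>: on finite support the value is
      forced.\<close>
    have R: "R (\<lambda>Q. indicator (S m) Q * a Q) = Z_class (\<lambda>x. \<Sum>Q | indicator (S m) Q * a Q \<noteq> 0.
        indicator (S m) Q * a Q * dyadic_dilate \<psi> Q x)" if "extends_synthesis \<psi> R" for R
      using that[unfolded extends_synthesis_def, THEN conjunct2, rule_format, OF fin] by (rule conjunct2)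
    show ?thesis
      by (rule trans[OF R[OF T'[THEN conjunct1]] R[OF ext, symmetric]])
  qed
  ultimately have lim: "(\<lambda>m. synthesis \<psi> (\<lambda>Q. indicator (S m) Q * a Q) \<phi>) \<longlonglongrightarrow> T' a \<phi>"
    if "\<phi> \<in> Z_space" for \<phi>
    using that by (simp add: limitin_Z_dual_weak_star)
  have "T' a \<in> extensional Z_space"
    using T' a by (auto simp: extends_synthesis_def Z_dual_def)
  then show "T' a = synthesis \<psi> a"
  proof (rule extensionalityI)
    show "T' a \<phi> = synthesis \<psi> a \<phi>" if "\<phi> \<in> Z_space" for \<phi>
      using lim[OF that] synthesis_truncation_limit[OF a that S(2)] S(3)
      by (intro LIMSEQ_unique[OF lim[OF that]]) auto
  qed (simp add: synthesis_def)
qed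

end
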